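(* Let $X$ be a compact manifold with embedded corners (all faces connected) with associated corner structure complex $\Sigma_X$. Then there is an isomorphism $$H^{cn}_*(X)\xrightarrow{\ \cong\ }\widetilde{H}_{*-1}(|\Sigma_X|),$$ where the left-hand side is the conormal homology of $X$ and the right-hand side is the reduced (integral) homology of the geometric realization of $\Sigma_X$.
   Context: A compact smooth manifold with embedded corners $X$ is given by a compact smooth manifold $\widetilde X$ without boundary and smooth maps $\rho_1,\dots,\rho_n\colon\widetilde X\to\mathbb{R}$ such that, with $X:=\bigcap_{j=1}^n\rho_j^{-1}([0,\infty))\subseteq\widetilde X$ (non-empty) and $H_j:=\rho_j^{-1}(0)\cap X$, for every $J\subseteq\{1,\dots,n\}$ the differentials $\{d\rho_j\}_{j\in J}$ have maximal rank $|J|$ (are linearly independent) at each point of $H_J:=\bigcap_{j\in J}H_j$ (with $H_\emptyset:=X$). The sets $H_j$, which are assumed non-empty, are the boundary components of codimension $1$; the non-empty $H_J$ with $|J|=k$ are the faces of codimension $k$. "All faces connected" means that every face of every codimension (including $X$ itself, the only face of codimension $0$) is connected. The corner structure complex $\Sigma_X$ is the abstract simplicial complex with vertex set $\{H_1,\dots,H_n\}$ in which $A$ is a simplex if and only if $\bigcap_{H\in A}H\neq\emptyset$. $|\Sigma_X|$ denotes its geometric realization. By convention, $\widetilde H_{-1}(\emptyset)=\mathbb{Z}$. Conormal homology $H^{cn}_*(X)$ is the homology of the following chain complex. $C_p(X)$ is the abelian group generated by symbols $f\otimes\varepsilon$, where $f=H_{j_1}\cap\dots\cap H_{j_p}$ is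 a (connected) face of codimension $p$ and $\varepsilon$ is an orientation of its conormal bundle, i.e. $\varepsilon=\pm e_{j_1}\wedge\dots\wedge e_{j_p}$ with $e_j$ the conormal class of $d\rho_j$, subject to $f\otimes(-\varepsilon)=-f\otimes\varepsilon$. The differential $C_p(X)\to C_{p-1}(X)$ is given by contraction: $$f\otimes(e_{j_1}\wedge\dots\wedge e_{j_p})\mapsto\sum_{i=1}^p(-1)^{i-1}\,f_i\otimes(e_{j_1}\wedge\dots\wedge\widehat{e_{j_i}}\wedge\dots\wedge e_{j_p}),$$ where $f_i=\bigcap_{l\ne i}H_{j_l}$ is the codimension $p-1$ face obtained by omitting $H_{j_i}$. *)

theory Defs
  imports "HOL-Analysis.Analysis" "HOL-Homology.Homology" "HOL-Combinatorics.Combinatorics"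
begin

section \<open>Smooth functions on open subsets of Euclidean space\<close>

text \<open>
  The model space is \<^const>\<open>Euclidean_space\<close> \<open>d\<close>, so that the dimension \<open>d\<close> is an arbitrary
  natural number (\<open>d = 0\<close> included). Smoothness is the existence and continuity of all iterated
  partial derivatives.
\<close>

definition partial_deriv :: "nat \<Rightarrow> ((nat \<Rightarrow> real) \<Rightarrow> real) \<Rightarrow> (nat \<Rightarrow> real) \<Rightarrow> real" where
  "partial_deriv i f x = deriv (\<lambda>t. f (x(i := t))) (x i)"

primrec Ck_on :: "nat \<Rightarrow> nat \<Rightarrow> (nat \<Rightarrow> real) set \<Rightarrow> ((nat \<Rightarrow> real) \<Rightarrow> real) \<Rightarrow> bool" where
  "Ck_on d 0 W f \<longleftrightarrow>
     continuous_map (subtopology (Euclidean_space d) W) euclideanreal f"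
| "Ck_on d (Suc k) W f \<longleftrightarrow>
     continuous_map (subtopology (Euclidean_space d) W) euclideanreal f \<and>
     (\<forall>i<d. (\<forall>x\<in>W. (\<lambda>t. f (x(i := t))) differentiable at (x i)) \<and>
             Ck_on d k W (partial_deriv i f))"

definition smooth_fun :: "nat \<Rightarrow> (nat \<Rightarrow> real) set \<Rightarrow> ((nat \<Rightarrow> real) \<Rightarrow> real) \<Rightarrow> bool" where
  "smooth_fun d W f \<longleftrightarrow> (\<forall>k. Ck_on d k W f)"

section \<open>Compact smooth manifolds without boundary\<close>

type_synonym 'a chart = "'a set \<times> ('a \<Rightarrow> nat \<Rightarrow> real)"

definition is_chart :: "'a topology \<Rightarrow> nat \<Rightarrow> 'a chart \<Rightarrow> bool" where
  "is_chart M d c \<longleftrightarrow> (case c of (U, \<phi>) \<Rightarrow>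
     openin M U \<and> openin (Euclidean_space d) (\<phi> ` U) \<and>
     homeomorphic_map (subtopology M U) (subtopology (Euclidean_space d) (\<phi> ` U)) \<phi>)"

definition smooth_transition :: "nat \<Rightarrow> 'a chart \<Rightarrow> 'a chart \<Rightarrow> bool" where
  "smooth_transition d c c' \<longleftrightarrow> (case c of (U, \<phi>) \<Rightarrow> case c' of (V, \<psi>) \<Rightarrow>
     (\<forall>i<d. smooth_fun d (\<phi> ` (U \<inter> V)) (\<lambda>y. \<psi> (inv_into U \<phi> y) i)))"

definition smooth_atlas :: "'a topology \<Rightarrow> nat \<Rightarrow> 'a chart set \<Rightarrow> bool" where
  "smooth_atlas M d A \<longleftrightarrow>
     (\<forall>c\<in>A. is_chart M d c) \<and> (\<Union>c\<in>A. fst c) = topspace M \<and>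
     (\<forall>c\<in>A. \<forall>c'\<in>A. smooth_transition d c c')"

definition compact_smooth_manifold :: "'a topology \<Rightarrow> nat \<Rightarrow> 'a chart set \<Rightarrow> bool" where
  "compact_smooth_manifold M d A \<longleftrightarrow>
     compact_space M \<and> Hausdorff_space M \<and> second_countable M \<and> smooth_atlas M d A"

definition smooth_real_map :: "nat \<Rightarrow> 'a chart set \<Rightarrow> ('a \<Rightarrow> real) \<Rightarrow> bool" where
  "smooth_real_map d A r \<longleftrightarrow>
     (\<forall>(U, \<phi>)\<in>A. smooth_fun d (\<phi> ` U) (\<lambda>y. r (inv_into U \<phi> y)))"

text \<open>The components, for \<open>i < d\<close>, of the differential of \<open>r\<close> at \<open>x\<close> in a chart around \<open>x\<close>.\<close>

definition differential_coord :: "'a chart \<Rightarrow> ('a \<Rightarrow> real) \<Rightarrow> 'a \<Rightarrow> nat \<Rightarrow> real" where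
  "differential_coord c r x i = (case c of (U, \<phi>) \<Rightarrow>
     partial_deriv i (\<lambda>y. r (inv_into U \<phi> y)) (\<phi> x))"

definition differentials_independent ::
    "nat \<Rightarrow> 'a chart set \<Rightarrow> (nat \<Rightarrow> 'a \<Rightarrow> real) \<Rightarrow> nat set \<Rightarrow> 'a \<Rightarrow> bool" where
  "differentials_independent d A r J x \<longleftrightarrow>
     (\<forall>c\<in>A. x \<in> fst c \<longrightarrow>
        (\<forall>a :: nat \<Rightarrow> real. (\<forall>i<d. (\<Sum>j\<in>J. a j * differential_coord c (r j) x i) = 0)
           \<longrightarrow> (\<forall>j\<in>J. a j = 0)))"

section \<open>Manifolds with embedded corners\<close>

text \<open>
  The data are the ambient manifold (space, dimension, atlas) and the defining functions
  \<open>\<rho>\<^sub>1, \<dots>, \<rho>\<^sub>n\<close>; only the values of \<^term>\<open>j\<close> in \<open>{1..n}\<close> matter in the last field.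
\<close>

record 'a corner_data =
  ambient :: "'a topology"
  ambient_dim :: nat
  ambient_atlas :: "'a chart set"
  num_bdf :: nat
  bdf :: "nat \<Rightarrow> 'a \<Rightarrow> real"

definition corner_space :: "'a corner_data \<Rightarrow> 'a set" where
  "corner_space X = {x \<in> topspace (ambient X). \<forall>j\<in>{1..num_bdf X}. 0 \<le> bdf X j x}"

definition hyperface :: "'a corner_data \<Rightarrow> nat \<Rightarrow> 'a set" where
  "hyperface X j = {x \<in> corner_space X. bdf X j x = 0}"

definition corner_face :: "'a corner_data \<Rightarrow> nat set \<Rightarrow> 'a set" where
  "corner_face X J = (if J = {} then corner_space X else (\<Inter>j\<in>J. hyperface X j))"

definition compact_manifold_embedded_corners :: "'a corner_data \<Rightarrow> bool" where
  "compact_manifold_embedded_corners X \<longleftrightarrow>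
     compact_smooth_manifold (ambient X) (ambient_dim X) (ambient_atlas X) \<and>
     (\<forall>j\<in>{1..num_bdf X}. smooth_real_map (ambient_dim X) (ambient_atlas X) (bdf X j)) \<and>
     corner_space X \<noteq> {} \<and>
     (\<forall>j\<in>{1..num_bdf X}. hyperface X j \<noteq> {}) \<and>
     (\<forall>J \<subseteq> {1..num_bdf X}. \<forall>x \<in> corner_face X J.
        differentials_independent (ambient_dim X) (ambient_atlas X) (bdf X) J x)"

definition faces_of_codim :: "'a corner_data \<Rightarrow> int \<Rightarrow> 'a set set" where
  "faces_of_codim X p =
     {corner_face X J | J. J \<subseteq> {1..num_bdf X} \<and> int (card J) = p \<and> corner_face X J \<noteq> {}}"

definition all_faces_connected :: "'a corner_data \<Rightarrow> bool" where
  "all_faces_connected X \<longleftrightarrow> (\<forall>p. \<forall>f \<in> faces_of_codim X p. connectedin (ambient X) f)"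

section \<open>The corner structure complex and its geometric realization\<close>

text \<open>
  The vertices are the sets \<open>H\<^sub>j\<close> themselves. The empty simplex belongs to the complex; it
  contributes no point to the geometric realization.
\<close>

definition corner_structure_complex :: "'a corner_data \<Rightarrow> 'a set set set" where
  "corner_structure_complex X = {A. A \<subseteq> hyperface X ` {1..num_bdf X} \<and> \<Inter>A \<noteq> {}}"

text \<open>
  Points are given by barycentric coordinates. For a finite complex, the only case used
  here, the topology of pointwise convergence coincides with the weak topology.
\<close>

definition geometric_realization :: "'v set set \<Rightarrow> ('v \<Rightarrow> real) topology" where
  "geometric_realization K =
     subtopology (powertop_real UNIV)
       {t. (\<forall>v. 0 \<le> t v) \<and> {v. t v \<noteq> 0} \<in> K \<and> (\<Sum>v | t v \<noteq> 0. t v) = 1}"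

section \<open>Conormal homology\<close>

text \<open>
  The triple \<open>(f, s, [j\<^sub>1, \<dots>, j\<^sub>p])\<close> with \<open>s = 1\<close> or \<open>s = -1\<close> stands for the symbol
  \<open>f \<otimes> (s \<cdot> e\<^bsub>j1\<^esub> \<and> \<dots> \<and> e\<^bsub>jp\<^esub>)\<close>. Degrees are integers, so that the complex is zero in
  negative degrees.
\<close>

type_synonym 'a conormal_symbol = "'a set \<times> int \<times> nat list"

definition conormal_symbols :: "'a corner_data \<Rightarrow> int \<Rightarrow> 'a conormal_symbol set" where
  "conormal_symbols X p =
     {(f, s, js). f \<in> faces_of_codim X p \<and> s \<in> {1, - 1} \<and>
        distinct js \<and> set js \<subseteq> {1..num_bdf X} \<and> int (length js) = p \<and>
        f = corner_face X (set js)}"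

text \<open>
  The first relations are \<open>f \<otimes> (-\<epsilon>) = - f \<otimes> \<epsilon>\<close>; the second ones identify the expressions that
  denote the same orientation, since permuting the factors of \<open>e\<^bsub>j1\<^esub> \<and> \<dots> \<and> e\<^bsub>jp\<^esub>\<close> multiplies it
  by the sign of the permutation.
\<close>

definition conormal_relations :: "'a corner_data \<Rightarrow> int \<Rightarrow> ('a conormal_symbol \<Rightarrow>\<^sub>0 int) set" where
  "conormal_relations X p =
     generate (free_Abelian_group (conormal_symbols X p))
       ({frag_of (f, - s, js) + frag_of (f, s, js) | f s js. (f, s, js) \<in> conormal_symbols X p} \<union>
        {frag_of (f, sign \<pi> * s, permute_list \<pi> js) - frag_of (f, s, js) | f s js \<pi>.
           (f, s, js) \<in> conormal_symbols X p \<and> \<pi> permutes {..<length js}})"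

definition conormal_chain_group ::
    "'a corner_data \<Rightarrow> int \<Rightarrow> ('a conormal_symbol \<Rightarrow>\<^sub>0 int) set monoid" where
  "conormal_chain_group X p =
     free_Abelian_group (conormal_symbols X p) Mod conormal_relations X p"

text \<open>
  Positions in lists are counted from 0, whence the sign \<open>(-1)\<^sup>i\<close>.
\<close>

definition symbol_boundary ::
    "'a corner_data \<Rightarrow> 'a conormal_symbol \<Rightarrow> ('a conormal_symbol \<Rightarrow>\<^sub>0 int)" where
  "symbol_boundary X = (\<lambda>(f, s, js).
     \<Sum>i<length js. frag_cmul ((- 1) ^ i)
       (let ks = take i js @ drop (Suc i) js in frag_of (corner_face X (set ks), s, ks)))"

text \<open>
  The map induced on classes: the image of a class is the class of the boundary of any of its
  representatives.
\<close>

definition conormal_boundary ::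
    "'a corner_data \<Rightarrow> int \<Rightarrow> ('a conormal_symbol \<Rightarrow>\<^sub>0 int) set \<Rightarrow> ('a conormal_symbol \<Rightarrow>\<^sub>0 int) set"
  where
  "conormal_boundary X p S =
     (\<Union>c\<in>S. conormal_relations X (p - 1)
        #>\<^bsub>free_Abelian_group (conormal_symbols X (p - 1))\<^esub> frag_extend (symbol_boundary X) c)"

definition conormal_homology ::
    "'a corner_data \<Rightarrow> int \<Rightarrow> ('a conormal_symbol \<Rightarrow>\<^sub>0 int) set set monoid" where
  "conormal_homology X p =
     subgroup_generated (conormal_chain_group X p)
       (kernel (conormal_chain_group X p) (conormal_chain_group X (p - 1)) (conormal_boundary X p))
     Mod (conormal_boundary X (p + 1) ` carrier (conormal_chain_group X (p + 1)))"

end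

theory Submission
  imports Defs
begin

text \<open>
  Both sides are homologies of one combinatorial complex. Up to sign, a symbol \<open>f \<otimes> \<epsilon>\<close> of
  codimension \<open>p\<close> is determined by the set of the \<open>p\<close> indices that occur in \<open>\<epsilon>\<close>, and the
  increasing order of the indices singles out one of the two signs. In these coordinates contraction is
  the simplicial boundary. Conormal homology is therefore the homology of the oriented chains of the
  \<^emph>\<open>index complex\<close>, whose simplices are the sets of indices with a nonempty face
  (\<open>conormal_homology_iso\<close>). A set with \<open>p\<close> elements is a \<open>(p - 1)\<close>-simplex, whence the shift of degrees;
  the whole space, the face of the empty set of indices, plays the part of the empty simplex, so that the
  simplicial homology obtained is the reduced one.

  That reduced simplicial homology is the reduced singular homology of the realization is proved by
  sending every nonempty simplex to the affine singular simplex on its vertices in increasing order. This embeds the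
  oriented chains into the singular chains, and the quotient complex is acyclic
  (\<open>homology_carried_by_simplices\<close>): a singular chain with an affine boundary is an affine chain plus a
  boundary. The proof is an induction on the number of vertices. Away from its smallest vertex \<open>v\<close> the
  realization retracts onto the simplices that avoid \<open>v\<close>, the closed star of \<open>v\<close> is a cone, and
  the part of the star away from \<open>v\<close> retracts onto the link of \<open>v\<close>. The subcomplex avoiding \<open>v\<close> and the
  link have fewer vertices, for cones the claim is seen directly (\<open>homology_carried_by_star\<close>), and barycentric
  subdivision permits to glue the pieces chain by chain (\<open>homology_carried_by_glue\<close>).

  The vertices of the corner structure complex are the hyperfaces as sets, those of the index complex
  are their indices. Passing from indices to hyperfaces, and back to one chosen index for each hyperface,
  is contiguous to the identity, so the two realizations are homotopy equivalent
  (\<open>homotopy_equivalent_index_realization\<close>).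
\<close>

section \<open>Signs of orderings\<close>

text \<open>
  This is \<open>(-1)\<close> to the number of inversions, so for a list without repetitions it is the sign of
  the permutation that sorts the list.
\<close>

primrec list_sign :: "'b::linorder list \<Rightarrow> int" where
  "list_sign [] = 1"
| "list_sign (x # xs) = (- 1) ^ card {y \<in> set xs. y < x} * list_sign xs"

abbreviation delete_nth :: "nat \<Rightarrow> 'b list \<Rightarrow> 'b list" where
  "delete_nth i xs \<equiv> take i xs @ drop (Suc i) xs"

lemma set_delete_nth:
  assumes "distinct xs" "i < length xs"
  shows "set (delete_nth i xs) = set xs - {xs ! i}"
proof -
  have *: "xs = take i xs @ xs ! i # drop (Suc i) xs" using assms(2) by (rule id_take_nth_drop)
  have "set xs = set (delete_nth i xs) \<union> {xs ! i}"
    by (subst *) auto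
  moreover have "xs ! i \<notin> set (delete_nth i xs)"
  proof -
    have "distinct (take i xs @ xs ! i # drop (Suc i) xs)" using assms(1) by (subst *[symmetric])
    then show ?thesis by auto
  qed
  ultimately show ?thesis by blast
qed

lemma card_less_insert:
  fixes z :: "'b::linorder"
  assumes "finite A" "x \<notin> A"
  shows "card {y \<in> insert x A. y < z} = card {y \<in> A. y < z} + (if x < z then 1 else 0)"
proof -
  have "{y \<in> insert x A. y < z} = (if x < z then insert x {y \<in> A. y < z} else {y \<in> A. y < z})" by auto
  then show ?thesis using assms by auto
qed

text \<open>
  Deleting the entry at position \<open>i\<close> removes the inversions formed with larger entries before it and
  with smaller entries after it. The larger entries before it number \<open>i\<close> minus the smaller ones before
  it, so modulo 2 the loss is \<open>i\<close> plus the number of all smaller entries. This is what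
  turns the sign \<open>(-1)\<^sup>i\<close> of the contraction into the sign of the simplicial boundary.
\<close>

lemma list_sign_delete_nth:
  assumes "distinct xs" "i < length xs"
  shows "(- 1) ^ i * list_sign (delete_nth i xs) = (- 1) ^ card {y \<in> set xs. y < xs ! i} * list_sign xs"
  using assms
proof (induction xs arbitrary: i)
  case Nil then show ?case by simp
next
  case (Cons x xs)
  show ?case
  proof (cases i)
    case 0
    have "{y \<in> set (x # xs). y < x} = {y \<in> set xs. y < x}" by auto
    then show ?thesis using 0 by (simp flip: power_add mult.assoc)
  next
    case (Suc k)
    then have k: "k < length xs" and dx: "distinct xs" and xn: "x \<notin> set xs" using Cons.prems by auto
    have IH: "(- 1) ^ k * list_sign (delete_nth k xs) = (- 1) ^ card {y \<in> set xs. y < xs ! k} * list_sign xs"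
      using Cons.IH[OF dx k] .
    let ?b = "xs ! k" and ?D = "set (delete_nth k xs)"
    have D: "set xs = insert ?b ?D" "?b \<notin> ?D" unfolding set_delete_nth[OF dx k] using k by auto
    have c1: "card {y \<in> set xs. y < x} = card {y \<in> ?D. y < x} + (if ?b < x then 1 else 0)"
      unfolding D(1) by (rule card_less_insert[OF finite_set D(2)])
    have c2: "card {y \<in> set (x # xs). y < ?b} = card {y \<in> set xs. y < ?b} + (if x < ?b then 1 else 0)"
      using card_less_insert[of "set xs" x ?b] xn by simp
    have ne: "x \<noteq> ?b" using xn k by auto
    have parity: "(- 1) ^ (m + (if x < ?b then 1 else 0)) * ((- 1) ^ (n + (if ?b < x then 1 else 0)) * z)
        = - ((- 1) ^ n * ((- 1) ^ m * z))" for m n and z :: int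
      using ne by (cases "x < ?b") simp_all
    have "(- 1) ^ i * list_sign (delete_nth i (x # xs))
        = - ((- 1) ^ card {y \<in> ?D. y < x} * ((- 1) ^ k * list_sign (delete_nth k xs)))"
      using Suc by simp
    also have "\<dots> = - ((- 1) ^ card {y \<in> ?D. y < x} * ((- 1) ^ card {y \<in> set xs. y < ?b} * list_sign xs))"
      using IH by simp
    also have "\<dots> = (- 1) ^ card {y \<in> set (x # xs). y < (x # xs) ! i} * list_sign (x # xs)"
      unfolding list_sign.simps c1 Suc nth_Cons_Suc c2 by (rule parity[symmetric])
    finally show ?thesis .
  qed
qed

lemma list_sign_move_front:
  assumes "distinct (xs @ b # ys)"
  shows "list_sign (b # xs @ ys) = (- 1) ^ length xs * list_sign (xs @ b # ys)"
proof -
  let ?l = "xs @ b # ys"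
  have "(- 1) ^ length xs * list_sign (xs @ ys) = (- 1) ^ card {y \<in> set ?l. y < b} * list_sign ?l"
    using list_sign_delete_nth[OF assms, of "length xs"] by simp
  moreover have "{y \<in> set ?l. y < b} = {y \<in> set (xs @ ys). y < b}" by auto
  ultimately have *: "(- 1) ^ length xs * list_sign (xs @ ys) = (- 1) ^ card {y \<in> set (xs @ ys). y < b} * list_sign ?l" by simp
  have sq: "(- 1) ^ m * ((- 1) ^ m * z) = z" for m and z :: int
    by (simp flip: power_add mult.assoc)
  have "(- 1) ^ length xs * list_sign ?l
      = (- 1) ^ length xs * ((- 1) ^ card {y \<in> set (xs @ ys). y < b} * ((- 1) ^ length xs * list_sign (xs @ ys)))"
    unfolding * sq ..
  also have "\<dots> = (- 1) ^ card {y \<in> set (xs @ ys). y < b} * list_sign (xs @ ys)"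
    unfolding mult.left_commute[of "(- 1) ^ length xs"] sq ..
  finally show ?thesis by (simp only: list_sign.simps)
qed

text \<open>
  Entries in front of both are harmless. In each of the two lists, moving the later of the two entries
  to the front passes over the same number of entries, hence multiplies the sign by the same factor,
  and the lists so obtained differ only in the order of their first two entries.
\<close>

lemma list_sign_swap:
  assumes "distinct (xs @ a # ys @ b # zs)"
  shows "list_sign (xs @ b # ys @ a # zs) = - list_sign (xs @ a # ys @ b # zs)"
  using assms
proof (induction xs)
  case Nil
  have 1: "list_sign (b # (a # ys) @ zs) = (- 1) ^ length (a # ys) * list_sign ((a # ys) @ b # zs)"
    by (rule list_sign_move_front) (use Nil in auto)
  have 2: "list_sign (a # (b # ys) @ zs) = (- 1) ^ length (b # ys) * list_sign ((b # ys) @ a # zs)"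
    by (rule list_sign_move_front) (use Nil in auto)
  have 3: "list_sign (b # a # ys @ zs) = - list_sign (a # b # ys @ zs)"
  proof -
    let ?S = "set (ys @ zs)"
    have ab: "a \<noteq> b" "a \<notin> ?S" "b \<notin> ?S" using Nil by auto
    have "card {y \<in> set (a # ys @ zs). y < b} = card {y \<in> ?S. y < b} + (if a < b then 1 else 0)"
         "card {y \<in> set (b # ys @ zs). y < a} = card {y \<in> ?S. y < a} + (if b < a then 1 else 0)"
      using card_less_insert[of ?S a b] card_less_insert[of ?S b a] ab by simp_all
    moreover have "(- 1) ^ (m + (if a < b then 1 else 0)) * ((- 1) ^ n * z)
        = - ((- 1) ^ (n + (if b < a then 1 else 0)) * ((- 1) ^ m * z))" for m n and z :: int
      using ab(1) by (cases "a < b") (simp_all add: mult.left_commute)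
    ultimately show ?thesis by (simp only: list_sign.simps)
  qed
  have "(- 1) ^ Suc (length ys) * list_sign (a # ys @ b # zs) = - ((- 1) ^ Suc (length ys) * list_sign (b # ys @ a # zs))"
    using 1 2 3 by (simp del: list_sign.simps)
  then have "(- 1) ^ Suc (length ys) * (list_sign (a # ys @ b # zs) + list_sign (b # ys @ a # zs)) = 0"
    unfolding distrib_left by linarith
  then have "list_sign (a # ys @ b # zs) + list_sign (b # ys @ a # zs) = 0"
    by (simp only: mult_eq_0_iff power_eq_0_iff) simp
  then show ?case by (simp del: list_sign.simps)
next
  case (Cons x xs)
  have "{y \<in> set (xs @ b # ys @ a # zs). y < x} = {y \<in> set (xs @ a # ys @ b # zs). y < x}" by auto
  moreover have "list_sign (xs @ b # ys @ a # zs) = - list_sign (xs @ a # ys @ b # zs)"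
    using Cons by simp
  ultimately show ?case unfolding append_Cons list_sign.simps by (simp only: mult_minus_right)
qed

lemma list_sign_transpose:
  assumes "distinct js" "a < length js" "b < length js" "a \<noteq> b"
  shows "list_sign (permute_list (Transposition.transpose a b) js) = - list_sign js"
  using assms(2-4)
proof (induction a b rule: linorder_wlog)
  case (le a b)
  then have ab: "a < b" "b < length js" by auto
  define xs where "xs = take a js"
  define ys where "ys = take (b - Suc a) (drop (Suc a) js)"
  define zs where "zs = drop (Suc b) js"
  have js: "js = xs @ js ! a # ys @ js ! b # zs"
  proof -
    have "js = take a js @ js ! a # drop (Suc a) js" by (rule id_take_nth_drop) (use ab in simp)
    moreover have "drop (Suc a) js = ys @ js ! b # zs"
      using id_take_nth_drop[of "b - Suc a" "drop (Suc a) js"] ab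
      by (simp add: ys_def zs_def)
    ultimately show ?thesis by (simp add: xs_def)
  qed
  have len: "length xs = a" "length ys = b - Suc a" using ab by (auto simp: xs_def ys_def)
  have "permute_list (Transposition.transpose a b) js = xs @ js ! b # ys @ js ! a # zs"
  proof (rule nth_equalityI)
    show "length (permute_list (Transposition.transpose a b) js) = length (xs @ js ! b # ys @ js ! a # zs)"
      by (subst js) simp
  next
    fix i assume "i < length (permute_list (Transposition.transpose a b) js)"
    then have i: "i < length js" by simp
    have p: "Transposition.transpose a b permutes {..<length js}" using ab by (intro permutes_swap_id) auto
    have "permute_list (Transposition.transpose a b) js ! i = js ! (Transposition.transpose a b i)" using permute_list_nth[OF p i] .
    also have "\<dots> = (xs @ js ! b # ys @ js ! a # zs) ! i"
    proof -
      consider "i = a" | "i = b" | "i \<noteq> a" "i \<noteq> b" by blast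
      then show ?thesis
      proof cases
        case 1 then show ?thesis using len by (simp add: nth_append)
      next
        case 2 then show ?thesis using len ab by (simp add: nth_append nth_Cons')
      next
        case 3
        then have "Transposition.transpose a b i = i" by (simp add: Transposition.transpose_def)
        moreover have "js ! i = (xs @ js ! a # ys @ js ! b # zs) ! i" using arg_cong[OF js, of "\<lambda>l. l ! i"] .
        moreover have "(xs @ js ! a # ys @ js ! b # zs) ! i = (xs @ js ! b # ys @ js ! a # zs) ! i"
          using 3 len ab by (auto simp: nth_append nth_Cons')
        ultimately show ?thesis by simp
      qed
    qed
    finally show "permute_list (Transposition.transpose a b) js ! i = (xs @ js ! b # ys @ js ! a # zs) ! i" .
  qed
  moreover have "list_sign (xs @ js ! b # ys @ js ! a # zs) = - list_sign (xs @ js ! a # ys @ js ! b # zs)"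
    by (rule list_sign_swap) (subst js[symmetric], rule assms(1))
  ultimately show ?case by (simp only: js[symmetric])
next
  case (sym a b)
  then show ?case by (simp add: transpose_commute)
qed

lemma list_sign_permute:
  fixes js :: "'b::linorder list"
  assumes "distinct js" "\<pi> permutes {..<length js}"
  shows "list_sign (permute_list \<pi> js) = sign \<pi> * list_sign js"
proof -
  have "finite {..<length js}" by simp
  from assms(2) this have "\<forall>ks :: 'b list. distinct ks \<and> length ks = length js \<longrightarrow> list_sign (permute_list \<pi> ks) = sign \<pi> * list_sign ks"
  proof (induction rule: permutes_induct)
    case id then show ?case by (simp add: sign_id)
  next
    case (swap a b p)
    show ?case
    proof (intro allI impI)
      fix ks :: "'b list" assume ks: "distinct ks \<and> length ks = length js"
      have pt: "Transposition.transpose a b permutes {..<length ks}" using swap ks by (intro permutes_swap_id) auto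
      have "permute_list (Transposition.transpose a b \<circ> p) ks = permute_list p (permute_list (Transposition.transpose a b) ks)"
        by (rule permute_list_compose) (use swap ks in auto)
      moreover have "distinct (permute_list (Transposition.transpose a b) ks)" using ks pt by simp
      ultimately have "list_sign (permute_list (Transposition.transpose a b \<circ> p) ks) = sign p * list_sign (permute_list (Transposition.transpose a b) ks)"
        using swap ks by simp
      also have "\<dots> = - sign p * list_sign ks"
        using list_sign_transpose[of ks a b] ks swap by simp
      also have "- sign p = sign (Transposition.transpose a b \<circ> p)"
        using swap sign_compose[of "Transposition.transpose a b" p] permutation_swap_id permutation_permutes
        by (metis finite_lessThan mult_minus1 sign_swap_id)
      finally show "list_sign (permute_list (Transposition.transpose a b \<circ> p) ks) = sign (Transposition.transpose a b \<circ> p) * list_sign ks" .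
    qed
  qed
  then show ?thesis using assms by blast
qed

lemma list_sign_sorted: "sorted_wrt (<) xs \<Longrightarrow> list_sign xs = 1"
proof (induction xs)
  case (Cons x xs)
  then have "{y \<in> set xs. y < x} = {}" by auto
  then have c: "card {y \<in> set xs. y < x} = 0" by (simp only: card.empty)
  show ?case unfolding list_sign.simps c using Cons by simp
qed simp

section \<open>Oriented simplicial chains as singular chains\<close>

definition face_boundary :: "'v::linorder set \<Rightarrow> ('v set \<Rightarrow>\<^sub>0 int)" where
  "face_boundary J = (\<Sum>j\<in>J. frag_cmul ((- 1) ^ card {i \<in> J. i < j}) (frag_of (J - {j})))"

definition oriented_boundary :: "('v::linorder set \<Rightarrow>\<^sub>0 int) \<Rightarrow> ('v set \<Rightarrow>\<^sub>0 int)" where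
  "oriented_boundary = frag_extend face_boundary"

lemma oriented_boundary_add: "oriented_boundary (x + y) = oriented_boundary x + oriented_boundary y"
  by (simp add: oriented_boundary_def frag_extend_add)

text \<open>
  Over a simplex that already contains \<open>v\<close> the cone would be degenerate; it is set to zero, which
  makes coning a contracting homotopy without exceptions.
\<close>

definition cone_face :: "'v \<Rightarrow> 'v set \<Rightarrow> ('v set \<Rightarrow>\<^sub>0 int)" where
  "cone_face v J = (if v \<in> J then 0 else frag_of (insert v J))"

lemma cone_face_boundary:
  assumes "finite J" "\<And>j. j \<in> J \<Longrightarrow> v \<le> j"
  shows "oriented_boundary (cone_face v J) + frag_extend (cone_face v) (face_boundary J) = frag_of J"
proof (cases "v \<in> J")
  case True
  have e: "(- 1 :: int) ^ card {i \<in> J. i < v} = 1"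
  proof -
    have "{i \<in> J. i < v} = {}" using leD[OF assms(2)] by blast
    then show ?thesis by (simp only: card.empty power_0)
  qed
  have "frag_extend (cone_face v) (face_boundary J)
      = (\<Sum>j\<in>J. frag_cmul ((- 1) ^ card {i \<in> J. i < j}) (cone_face v (J - {j})))"
    by (simp add: face_boundary_def frag_extend_sum assms frag_extend_cmul o_def)
  also have "\<dots> = (\<Sum>j\<in>J. if j = v then frag_of J else 0)"
    by (rule sum.cong) (use True in \<open>auto simp: e cone_face_def insert_absorb\<close>)
  also have "\<dots> = frag_of J" using True assms by simp
  finally show ?thesis using True by (simp add: cone_face_def oriented_boundary_def)
next
  case False
  have e: "(- 1 :: int) ^ card {i \<in> insert v J. i < v} = 1"
  proof -
    have "{i \<in> insert v J. i < v} = {}" using leD[OF assms(2)] by blast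
    then show ?thesis by (simp only: card.empty power_0)
  qed
  have *: "card {i \<in> insert v J. i < j} = Suc (card {i \<in> J. i < j})" if "j \<in> J" for j
  proof -
    have "v \<noteq> j" using that False by blast
    then have "v < j" using assms(2)[OF that] by simp
    then have "{i \<in> insert v J. i < j} = insert v {i \<in> J. i < j}" by auto
    then show ?thesis using False assms by simp
  qed
  have "oriented_boundary (cone_face v J) = face_boundary (insert v J)"
    using False by (simp add: cone_face_def oriented_boundary_def)
  also have "\<dots> = frag_of J + (\<Sum>j\<in>J. frag_cmul ((- 1) ^ card {i \<in> insert v J. i < j}) (frag_of (insert v J - {j})))"
    unfolding face_boundary_def sum.insert[OF assms(1) False] e using False by (simp add: insert_Diff_if)
  also have "(\<Sum>j\<in>J. frag_cmul ((- 1) ^ card {i \<in> insert v J. i < j}) (frag_of (insert v J - {j})))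
      = (\<Sum>j\<in>J. - frag_cmul ((- 1) ^ card {i \<in> J. i < j}) (cone_face v (J - {j})))"
  proof (rule sum.cong[OF refl])
    fix j assume j: "j \<in> J"
    then have "insert v J - {j} = insert v (J - {j})" using False by auto
    then show "frag_cmul ((- 1) ^ card {i \<in> insert v J. i < j}) (frag_of (insert v J - {j}))
       = - frag_cmul ((- 1) ^ card {i \<in> J. i < j}) (cone_face v (J - {j}))"
      using *[OF j] False by (simp add: cone_face_def)
  qed
  also have "\<dots> = - frag_extend (cone_face v) (face_boundary J)"
    by (simp add: face_boundary_def frag_extend_sum assms frag_extend_cmul o_def sum_negf del: minus_frag_cmul)
  finally show ?thesis by simp
qed

text \<open>
  Coning with a vertex below all others contracts the augmented oriented complex: the apex comes first
  in the increasing order, so the face opposite to it carries the sign \<open>+1\<close>, while the position of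
  every other vertex is raised by one, which reverses the sign of the face opposite to it.
\<close>

lemma cone_oriented_boundary:
  assumes "\<And>J. J \<in> Poly_Mapping.keys x \<Longrightarrow> finite J \<and> (\<forall>j\<in>J. v \<le> j)"
  shows "oriented_boundary (frag_extend (cone_face v) x) + frag_extend (cone_face v) (oriented_boundary x) = x"
proof -
  have "Poly_Mapping.keys x \<subseteq> {J. finite J \<and> (\<forall>j\<in>J. v \<le> j)}" using assms by auto
  then show ?thesis
  proof (induction x rule: frag_induction)
    case (one J)
    then show ?case using cone_face_boundary[of J v] by (simp add: oriented_boundary_def)
  next
    case (diff a b)
    then show ?case unfolding oriented_boundary_def frag_extend_diff
      by (metis (no_types, lifting) add_diff_add)
  qed (simp add: oriented_boundary_def)
qed

definition vertex_point :: "'v \<Rightarrow> 'v \<Rightarrow> real" where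
  "vertex_point j = (\<lambda>i. if i = j then 1 else 0)"

text \<open>
  The vertices of the affine simplex are taken in increasing order. Only nonempty \<open>J\<close> are meaningful:
  truncated subtraction assigns an arbitrary 0-simplex to the empty set.
\<close>

definition affine_simplex :: "'v::linorder set \<Rightarrow> (nat \<Rightarrow> real) \<Rightarrow> ('v \<Rightarrow> real)" where
  "affine_simplex J = oriented_simplex (card J - 1) (\<lambda>k. vertex_point (sorted_list_of_set J ! k))"

definition affine_chain :: "('v::linorder set \<Rightarrow>\<^sub>0 int) \<Rightarrow> ('v \<Rightarrow> real) chain" where
  "affine_chain = frag_extend (frag_of \<circ> affine_simplex)"

lemma vertex_point_eq_iff: "vertex_point i = vertex_point j \<longleftrightarrow> i = j"
  by (auto simp: vertex_point_def fun_eq_iff split: if_splits)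

lemma inj_on_affine_simplex: "inj_on affine_simplex {J :: 'v::linorder set. finite J \<and> card J = Suc n}"
proof (rule inj_onI)
  fix I J :: "'v set" assume I: "I \<in> {J. finite J \<and> card J = Suc n}" and J: "J \<in> {J. finite J \<and> card J = Suc n}"
    and eq: "affine_simplex I = affine_simplex J"
  have "sorted_list_of_set I = sorted_list_of_set J"
  proof (rule nth_equalityI)
    show "length (sorted_list_of_set I) = length (sorted_list_of_set J)" using I J by simp
    fix i assume "i < length (sorted_list_of_set I)"
    then show "sorted_list_of_set I ! i = sorted_list_of_set J ! i"
      using eq I J by (auto simp: affine_simplex_def oriented_simplex_eq vertex_point_eq_iff less_Suc_eq_le)
  qed
  then show "I = J" using I J by (metis (mono_tags, lifting) mem_Collect_eq set_sorted_list_of_set)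
qed

text \<open>
  An affine simplex determines the list of its vertices, so that oriented chains embed into
  singular chains.
\<close>

lemma affine_chain_eq_0:
  fixes x :: "'v::linorder set \<Rightarrow>\<^sub>0 int"
  assumes "Poly_Mapping.keys x \<subseteq> {J. finite J \<and> card J = Suc n}" "affine_chain x = 0"
  shows "x = 0"
proof -
  let ?A = "{J :: 'v set. finite J \<and> card J = Suc n}"
  have "frag_extend (frag_of \<circ> inv_into ?A affine_simplex) (affine_chain x)
      = frag_extend (frag_extend (frag_of \<circ> inv_into ?A affine_simplex) \<circ> (frag_of \<circ> affine_simplex)) x"
    unfolding affine_chain_def 
    using assms(1)
    by (induction x rule: frag_induction) (auto simp: frag_extend_diff)
  also have "\<dots> = frag_extend frag_of x"
  proof (rule frag_extend_eq)
    fix J assume "J \<in> Poly_Mapping.keys x"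
    then have "J \<in> ?A" using assms(1) by blast
    from inv_into_f_f[OF inj_on_affine_simplex this]
    show "(frag_extend (frag_of \<circ> inv_into ?A affine_simplex) \<circ> (frag_of \<circ> affine_simplex)) J = frag_of J"
      by simp
  qed
  finally show ?thesis using assms(2) by (simp flip: frag_expansion)
qed

lemma sorted_list_of_set_remove_nth:
  assumes "finite J" "k < card J"
  shows "sorted_list_of_set (J - {sorted_list_of_set J ! k})
       = take k (sorted_list_of_set J) @ drop (Suc k) (sorted_list_of_set J)"
proof -
  let ?s = "sorted_list_of_set J"
  have s: "?s = take k ?s @ ?s ! k # drop (Suc k) ?s"
    by (rule id_take_nth_drop) (use assms in simp)
  have "distinct (take k ?s @ ?s ! k # drop (Suc k) ?s)"
    by (subst s[symmetric]) simp
  then have d: "distinct (take k ?s @ drop (Suc k) ?s)"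
    and n: "?s ! k \<notin> set (take k ?s @ drop (Suc k) ?s)" by auto
  have "sorted (take k ?s @ ?s ! k # drop (Suc k) ?s)"
    by (subst s[symmetric]) simp
  then have so: "sorted (take k ?s @ drop (Suc k) ?s)" by (simp add: sorted_append)
  have "J = set ?s" using assms by simp
  also have "\<dots> = insert (?s ! k) (set (take k ?s @ drop (Suc k) ?s))"
    by (subst s) auto
  finally have "J - {?s ! k} = set (take k ?s @ drop (Suc k) ?s)" using n by blast
  then show ?thesis using d so by (metis sorted_list_of_set.idem_if_sorted_distinct)
qed

lemma card_less_sorted_nth:
  assumes "finite J" "k < card J"
  shows "card {i \<in> J. i < sorted_list_of_set J ! k} = k"
proof -
  let ?s = "sorted_list_of_set J"
  have st: "sorted_wrt (<) ?s" by simp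
  have "{i \<in> J. i < ?s ! k} = (!) ?s ` {..<k}"
  proof (intro equalityI subsetI)
    fix i assume i: "i \<in> {i \<in> J. i < ?s ! k}"
    then have "i \<in> set ?s" using assms(1) by simp
    then obtain m where m: "m < length ?s" "i = ?s ! m"
      by (metis in_set_conv_nth)
    have "m < k"
    proof (rule ccontr)
      assume "\<not> m < k"
      then have "?s ! k \<le> ?s ! m" using m by (intro sorted_nth_mono) auto
      moreover have "i < ?s ! k" using i by blast
      ultimately show False unfolding m(2) by (rule leD[THEN notE])
    qed
    then show "i \<in> (!) ?s ` {..<k}" using m by auto
  next
    fix i assume "i \<in> (!) ?s ` {..<k}"
    then obtain m where m: "m < k" "i = ?s ! m" by auto
    then have "?s ! m < ?s ! k" using assms by (intro sorted_wrt_nth_less[OF st]) auto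
    moreover have "?s ! m \<in> set ?s" using m assms by (intro nth_mem) auto
    ultimately show "i \<in> {i \<in> J. i < ?s ! k}" using m assms by simp
  qed
  moreover have "inj_on ((!) ?s) {..<k}" by (rule inj_on_nth) (use assms in auto)
  ultimately show ?thesis by (simp add: card_image)
qed

text \<open>
  The \<open>k\<close>-th singular face omits the \<open>k\<close>-th smallest vertex, and exactly \<open>k\<close> vertices are smaller than
  that one; so the signs of the two boundaries agree.
\<close>

lemma chain_boundary_affine_simplex:
  assumes "finite J" "card J = Suc (Suc n)"
  shows "chain_boundary (Suc n) (frag_of (affine_simplex J)) = affine_chain (face_boundary J)"
proof -
  let ?s = "sorted_list_of_set J"
  have face: "singular_face (Suc n) k (affine_simplex J) = affine_simplex (J - {?s ! k})" if "k \<le> Suc n" for k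
  proof -
    have k: "k < card J" using that assms by simp
    have "?s ! k \<in> J" using k assms by (metis nth_mem length_sorted_list_of_set set_sorted_list_of_set)
    then have c: "card (J - {?s ! k}) = Suc n" using assms by simp
    have "singular_face (Suc n) k (affine_simplex J)
        = oriented_simplex n (\<lambda>j. if j < k then vertex_point (?s ! j) else vertex_point (?s ! Suc j))"
      using that assms by (simp add: affine_simplex_def singular_face_oriented_simplex)
    also have "\<dots> = affine_simplex (J - {?s ! k})"
      unfolding affine_simplex_def c sorted_list_of_set_remove_nth[OF assms(1) k] diff_Suc_1
      unfolding oriented_simplex_eq using assms that by (auto simp: nth_append)
    finally show ?thesis .
  qed
  have bij: "bij_betw ((!) ?s) {..Suc n} J"
    using bij_betw_nth[of ?s "{..Suc n}" J] assms by (auto simp: lessThan_Suc_atMost)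
  have "affine_chain (face_boundary J) = (\<Sum>j\<in>J. frag_cmul ((- 1) ^ card {i \<in> J. i < j}) (frag_of (affine_simplex (J - {j}))))"
    using assms(1) by (simp add: affine_chain_def face_boundary_def frag_extend_sum frag_extend_cmul o_def)
  also have "\<dots> = (\<Sum>k\<le>Suc n. frag_cmul ((- 1) ^ card {i \<in> J. i < ?s ! k}) (frag_of (affine_simplex (J - {?s ! k}))))"
    by (rule sum.reindex_bij_betw[OF bij, symmetric])
  also have "\<dots> = (\<Sum>k\<le>Suc n. frag_cmul ((- 1) ^ k) (frag_of (singular_face (Suc n) k (affine_simplex J))))"
    by (rule sum.cong) (simp_all add: face card_less_sorted_nth assms)
  also have "\<dots> = chain_boundary (Suc n) (frag_of (affine_simplex J))"
    by (simp add: chain_boundary_of)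
  finally show ?thesis by simp
qed

lemma chain_boundary_affine_chain:
  assumes "Poly_Mapping.keys x \<subseteq> {J. finite J \<and> card J = Suc (Suc n)}"
  shows "chain_boundary (Suc n) (affine_chain x) = affine_chain (oriented_boundary x)"
  using assms
proof (induction x rule: frag_induction)
  case (one J)
  then show ?case using chain_boundary_affine_simplex[of J n] by (simp add: affine_chain_def oriented_boundary_def)
next
  case (diff a b)
  then show ?case
    unfolding affine_chain_def oriented_boundary_def frag_extend_diff chain_boundary_diff by simp
qed (simp add: affine_chain_def oriented_boundary_def)

section \<open>Finite simplicial complexes and affine chains\<close>

text \<open>
  The empty simplex is part of every complex. It carries no point of the realization and accounts for
  the augmentation.
\<close>

definition finite_complex :: "'v set set \<Rightarrow> bool" where
  "finite_complex K \<longleftrightarrow> {} \<in> K \<and> finite (\<Union>K) \<and> (\<forall>J\<in>K. \<forall>I\<subseteq>J. I \<in> K)"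

lemma finite_complex_finite: "finite_complex K \<Longrightarrow> J \<in> K \<Longrightarrow> finite J"
  by (meson Union_upper finite_subset finite_complex_def)

lemma finite_complex_subset: "finite_complex K \<Longrightarrow> J \<in> K \<Longrightarrow> I \<subseteq> J \<Longrightarrow> I \<in> K"
  by (auto simp: finite_complex_def)

lemma finite_complex_faces:
  "finite_complex K \<Longrightarrow> {J \<in> K. card J = n} \<subseteq> {J. finite J \<and> card J = n}"
  using finite_complex_finite by auto

definition realization_set :: "'v set set \<Rightarrow> ('v \<Rightarrow> real) set" where
  "realization_set K = {t. (\<forall>v. 0 \<le> t v) \<and> {v. t v \<noteq> 0} \<in> K \<and> (\<Sum>v | t v \<noteq> 0. t v) = 1}"

lemma geometric_realization_eq:
  "geometric_realization K = subtopology (powertop_real UNIV) (realization_set K)"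
  by (simp add: geometric_realization_def realization_set_def)

lemma realization_setI:
  assumes "finite J" "\<And>v. 0 \<le> t v" "\<And>v. v \<notin> J \<Longrightarrow> t v = 0" "{v. t v \<noteq> 0} \<in> K" "(\<Sum>v\<in>J. t v) = 1"
  shows "t \<in> realization_set K"
proof -
  have "(\<Sum>v | t v \<noteq> 0. t v) = (\<Sum>v\<in>J. t v)"
    by (rule sum.mono_neutral_left) (use assms in auto)
  then show ?thesis using assms by (simp add: realization_set_def)
qed

lemma realization_set_sum:
  assumes "t \<in> realization_set K" "finite J" "{v. t v \<noteq> 0} \<subseteq> J"
  shows "(\<Sum>v\<in>J. t v) = 1"
proof -
  have "(\<Sum>v | t v \<noteq> 0. t v) = (\<Sum>v\<in>J. t v)"
    by (rule sum.mono_neutral_left) (use assms in auto)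
  then show ?thesis using assms(1) by (simp add: realization_set_def)
qed

lemma realization_set_support:
  "t \<in> realization_set K \<Longrightarrow> {v. t v \<noteq> 0} \<in> K" "t \<in> realization_set K \<Longrightarrow> 0 \<le> t v"
  by (auto simp: realization_set_def)

lemma affine_simplex_apply:
  assumes "finite J" "card J = Suc n" "x \<in> standard_simplex n"
  shows "affine_simplex J x i = (\<Sum>k\<le>n. if sorted_list_of_set J ! k = i then x k else 0)"
  using assms
  by (auto simp: affine_simplex_def oriented_simplex_def vertex_point_def intro!: sum.cong)

text \<open>
  In barycentric coordinates, the affine simplex on \<open>J\<close> sends a point of the standard simplex to the
  point with the same coordinates, distributed over the elements of \<open>J\<close>.
\<close>

lemma affine_simplex_image:
  assumes K: "finite_complex K" and J: "J \<in> K" "card J = Suc n"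
  shows "affine_simplex J ` standard_simplex n \<subseteq> realization_set K"
proof
  fix t assume "t \<in> affine_simplex J ` standard_simplex n"
  then obtain x where x: "x \<in> standard_simplex n" "t = affine_simplex J x" by auto
  have fJ: "finite J" using K J finite_complex_finite by auto
  have t: "t i = (\<Sum>k\<le>n. if sorted_list_of_set J ! k = i then x k else 0)" for i
    using affine_simplex_apply[OF fJ J(2) x(1)] x(2) by simp
  have nJ: "sorted_list_of_set J ! k \<in> J" if "k \<le> n" for k
    using that fJ J(2) by (metis length_sorted_list_of_set less_Suc_eq_le nth_mem set_sorted_list_of_set)
  have zero: "t i = 0" if "i \<notin> J" for i
    unfolding t by (rule sum.neutral) (use nJ that in auto)
  show "t \<in> realization_set K"
  proof (rule realization_setI[OF fJ])
    show "0 \<le> t v" for v unfolding t by (rule sum_nonneg) (use x in \<open>auto simp: standard_simplex_def\<close>)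
    show "t v = 0" if "v \<notin> J" for v using zero that .
    show "{v. t v \<noteq> 0} \<in> K" using zero by (intro finite_complex_subset[OF K J(1)]) auto
    have "(\<Sum>v\<in>J. t v) = (\<Sum>k\<le>n. \<Sum>v\<in>J. if sorted_list_of_set J ! k = v then x k else 0)"
      unfolding t by (rule sum.swap)
    also have "\<dots> = (\<Sum>k\<le>n. x k)"
      by (rule sum.cong) (use nJ fJ in auto)
    finally show "(\<Sum>v\<in>J. t v) = 1" using x by (simp add: standard_simplex_def)
  qed
qed

lemma singular_simplex_affine_simplex:
  assumes K: "finite_complex K" and J: "J \<in> K" "card J = Suc n"
  shows "singular_simplex n (subtopology (powertop_real UNIV) (realization_set K)) (affine_simplex J)"
proof -
  have "simplicial_simplex n (realization_set K) (affine_simplex J)"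
    using affine_simplex_image[OF assms] J(2) by (auto simp: simplicial_simplex affine_simplex_def)
  then show ?thesis by (rule simplicial_imp_singular_simplex)
qed

definition affine_chain_in :: "nat \<Rightarrow> 'v::linorder set set \<Rightarrow> ('v \<Rightarrow> real) chain \<Rightarrow> bool" where
  "affine_chain_in n K c \<longleftrightarrow> Poly_Mapping.keys c \<subseteq> affine_simplex ` {J \<in> K. card J = Suc n}"

lemma affine_chain_in_0 [simp]: "affine_chain_in n K 0"
  by (simp add: affine_chain_in_def)

lemma affine_chain_in_add: "affine_chain_in n K a \<Longrightarrow> affine_chain_in n K b \<Longrightarrow> affine_chain_in n K (a + b)"
  unfolding affine_chain_in_def by (meson Un_least keys_add subset_trans)

lemma affine_chain_in_minus: "affine_chain_in n K (- a) \<longleftrightarrow> affine_chain_in n K a"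
  by (simp add: affine_chain_in_def)

lemma affine_chain_in_diff: "affine_chain_in n K a \<Longrightarrow> affine_chain_in n K b \<Longrightarrow> affine_chain_in n K (a - b)"
  unfolding affine_chain_in_def by (meson Un_least keys_diff subset_trans)

lemma affine_chain_in_mono: "affine_chain_in n K a \<Longrightarrow> K \<subseteq> L \<Longrightarrow> affine_chain_in n L a"
  unfolding affine_chain_in_def by blast

lemma affine_chain_in_affine_chain:
  assumes "Poly_Mapping.keys x \<subseteq> {J \<in> K. card J = Suc n}"
  shows "affine_chain_in n K (affine_chain x)"
  using assms unfolding affine_chain_in_def affine_chain_def
  by (intro subset_trans[OF keys_frag_extend]) auto

lemma affine_chain_inE:
  assumes "affine_chain_in n K c"
  obtains x where "Poly_Mapping.keys x \<subseteq> {J \<in> K. card J = Suc n}" "c = affine_chain x"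
proof -
  let ?A = "{J \<in> K. card J = Suc n}"
  let ?x = "frag_extend (frag_of \<circ> inv_into ?A affine_simplex) c"
  have k: "Poly_Mapping.keys c \<subseteq> affine_simplex ` ?A" using assms by (simp add: affine_chain_in_def)
  have "Poly_Mapping.keys ?x \<subseteq> ?A"
    by (rule subset_trans[OF keys_frag_extend]) (use k inv_into_into[of _ affine_simplex ?A] in auto)
  moreover have "affine_chain ?x = c"
    using k
  proof (induction c rule: frag_induction)
    case (one f)
    then show ?case using f_inv_into_f[of f affine_simplex ?A] by (simp add: affine_chain_def)
  qed (simp_all add: affine_chain_def frag_extend_diff)
  ultimately show thesis by (intro that[of ?x]) simp_all
qed

lemma affine_chain_in_Int:
  assumes "finite_complex D" "finite_complex E" "affine_chain_in n D c" "affine_chain_in n E c"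
  shows "affine_chain_in n (D \<inter> E) c"
  unfolding affine_chain_in_def
proof
  fix f assume "f \<in> Poly_Mapping.keys c"
  then obtain I J where I: "I \<in> D" "card I = Suc n" "f = affine_simplex I"
    and J: "J \<in> E" "card J = Suc n" "f = affine_simplex J"
    using assms(3,4) unfolding affine_chain_in_def by blast
  have "I = J" by (rule inj_onD[OF inj_on_affine_simplex[of n]])
    (use I J assms finite_complex_finite in auto)
  then show "f \<in> affine_simplex ` {J \<in> D \<inter> E. card J = Suc n}" using I J by blast
qed

lemma keys_oriented_boundary:
  assumes K: "finite_complex K" and x: "Poly_Mapping.keys x \<subseteq> {J \<in> K. card J = Suc n}"
  shows "Poly_Mapping.keys (oriented_boundary x) \<subseteq> {J \<in> K. card J = n}"
proof -
  have "Poly_Mapping.keys (face_boundary J) \<subseteq> {J \<in> K. card J = n}" if "J \<in> Poly_Mapping.keys x" for J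
  proof -
    have J: "J \<in> K" "card J = Suc n" "finite J" using that x finite_complex_finite[OF K] by auto
    show ?thesis unfolding face_boundary_def
      by (intro subset_trans[OF keys_sum] UN_least subset_trans[OF keys_cmul])
        (use J finite_complex_subset[OF K J(1)] in auto)
  qed
  then show ?thesis unfolding oriented_boundary_def
    by (intro subset_trans[OF keys_frag_extend] UN_least)
qed

lemma affine_chain_in_boundary:
  assumes K: "finite_complex K" and "affine_chain_in (Suc n) K c"
  shows "affine_chain_in n K (chain_boundary (Suc n) c)"
proof -
  obtain x where x: "Poly_Mapping.keys x \<subseteq> {J \<in> K. card J = Suc (Suc n)}" "c = affine_chain x"
    using assms(2) by (rule affine_chain_inE)
  have "chain_boundary (Suc n) c = affine_chain (oriented_boundary x)"
    unfolding x(2) by (rule chain_boundary_affine_chain)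
      (use x(1) finite_complex_faces[OF K] in blast)
  then show ?thesis using affine_chain_in_affine_chain keys_oriented_boundary[OF K x(1)] by simp
qed

lemma affine_chain_in_imp_singular_chain:
  assumes "finite_complex K" "affine_chain_in n K c"
  shows "singular_chain n (subtopology (powertop_real UNIV) (realization_set K)) c"
  using assms singular_simplex_affine_simplex unfolding affine_chain_in_def singular_chain_def by blast

lemma affine_chain_in_split:
  assumes "affine_chain_in n (D \<union> E) c"
  obtains d e where "affine_chain_in n D d" "affine_chain_in n E e" "c = d + e"
proof -
  have "Poly_Mapping.keys c \<subseteq> affine_simplex ` {J \<in> D. card J = Suc n} \<union> affine_simplex ` {J \<in> E. card J = Suc n}"
    using assms unfolding affine_chain_in_def by blast
  then obtain d e where "Poly_Mapping.keys d \<subseteq> affine_simplex ` {J \<in> D. card J = Suc n}"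
      "Poly_Mapping.keys e \<subseteq> affine_simplex ` {J \<in> E. card J = Suc n}" "d + e = c"
    by (rule frag_split)
  then show thesis by (intro that[of d e]) (simp_all add: affine_chain_in_def)
qed

section \<open>Acyclicity of singular modulo affine chains\<close>

text \<open>
  If the affine chains of \<open>K\<close> lie in \<open>S\<close>, this says that the quotient of the singular chain complex of
  \<open>S\<close> by the affine chains of \<open>K\<close> is acyclic. It contains both halves of the comparison of
  homologies: for a cycle \<open>z\<close> it gives surjectivity, and for \<open>z\<close> with an affine boundary it
  gives injectivity. In degree 0 there is no condition on the boundary. Unlike an isomorphism of
  homology groups, the property can be glued by moving single chains around.
\<close>

definition homology_carried_by :: "('v::linorder \<Rightarrow> real) set \<Rightarrow> 'v set set \<Rightarrow> bool" where
  "homology_carried_by S K \<longleftrightarrow>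
     (\<forall>n z. singular_chain n (subtopology (powertop_real UNIV) S) z \<and>
            (0 < n \<longrightarrow> affine_chain_in (n - 1) K (chain_boundary n z)) \<longrightarrow>
       (\<exists>y w. affine_chain_in n K y \<and> singular_chain (Suc n) (subtopology (powertop_real UNIV) S) w \<and>
              z = y + chain_boundary (Suc n) w))"

lemma homology_carried_byD:
  assumes "homology_carried_by S K" "singular_chain n (subtopology (powertop_real UNIV) S) z"
    "0 < n \<Longrightarrow> affine_chain_in (n - 1) K (chain_boundary n z)"
  obtains y w where "affine_chain_in n K y" "singular_chain (Suc n) (subtopology (powertop_real UNIV) S) w"
    "z = y + chain_boundary (Suc n) w"
  using assms unfolding homology_carried_by_def by blast

text \<open>
  A Mayer-Vietoris argument on chains. Subdivision makes \<open>z\<close> the sum of a chain in \<open>A\<close> and one in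
  \<open>B\<close>, up to a boundary. Their boundaries need not be affine separately, but they miss the affine
  parts \<open>cD\<close> and \<open>cE\<close> of the boundary of \<open>z\<close> by opposite chains \<open>e\<close> and \<open>-e\<close>, which lie in
  \<open>A \<inter> B\<close> and have an affine boundary there. Writing \<open>e\<close> as an affine chain plus the boundary of \<open>g\<close>
  and shifting \<open>g\<close> from one summand to the other makes both boundaries affine.
\<close>

lemma homology_carried_by_glue:
  fixes D E :: "'v::linorder set set"
  assumes D: "finite_complex D" and E: "finite_complex E"
    and DA: "realization_set D \<subseteq> A" and EB: "realization_set E \<subseteq> B"
    and AS: "A \<subseteq> S" and BS: "B \<subseteq> S"
    and oA: "openin (subtopology (powertop_real UNIV) S) A"
    and oU: "openin (subtopology (powertop_real UNIV) S) U" and UB: "U \<subseteq> B" and cover: "S \<subseteq> A \<union> U"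
    and hA: "homology_carried_by A D" and hB: "homology_carried_by B E"
    and hAB: "homology_carried_by (A \<inter> B) (D \<inter> E)"
  shows "homology_carried_by S (D \<union> E)"
  unfolding homology_carried_by_def
proof (intro allI impI)
  let ?P = "powertop_real (UNIV :: 'v set)"
  let ?sc = "\<lambda>n T. singular_chain n (subtopology ?P T)"
  fix n z
  assume asm: "?sc n S z \<and> (0 < n \<longrightarrow> affine_chain_in (n - 1) (D \<union> E) (chain_boundary n z))"
  have z: "?sc n S z" using asm by blast
  obtain cD cE where c: "affine_chain_in (n - 1) D cD" "affine_chain_in (n - 1) E cE"
    "chain_boundary n z = cD + cE" "n = 0 \<Longrightarrow> cD = 0 \<and> cE = 0"
  proof (cases "n = 0")
    case True
    then show thesis using that[of 0 0] by (simp add: chain_boundary_def)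
  next
    case False
    then show thesis using asm affine_chain_in_split[of "n - 1" D E] that by (metis gr0I)
  qed
  obtain m where m: "\<And>f. f \<in> Poly_Mapping.keys ((singular_subdivision n ^^ m) z)
      \<Longrightarrow> \<exists>V \<in> {A, U}. f \<in> standard_simplex n \<rightarrow> V"
  proof (rule sufficient_iterated_singular_subdivision_exists[of "{A, U}" "subtopology ?P S" n z])
    show "openin (subtopology ?P S) V" if "V \<in> {A, U}" for V using that oA oU by auto
    show "topspace (subtopology ?P S) \<subseteq> \<Union> {A, U}" using cover by auto
  qed (use z that in \<open>blast+\<close>)
  obtain h :: "nat \<Rightarrow> ('v \<Rightarrow> real) chain \<Rightarrow> ('v \<Rightarrow> real) chain" where h0: "\<And>p. h p 0 = 0"
    and hd: "\<And>p c1 c2. h p (c1 - c2) = h p c1 - h p c2"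
    and hs: "\<And>p X c. singular_chain p X c \<Longrightarrow> singular_chain (Suc p) X (h p c)"
    and hb: "\<And>p X c. singular_chain p X c
        \<Longrightarrow> chain_boundary (Suc p) (h p c) + h (p - Suc 0) (chain_boundary p c) = (singular_subdivision p ^^ m) c - c"
    using chain_homotopic_iterated_singular_subdivision[of m] by blast
  have ha: "h p (a + b) = h p a + h p b" for p a b
    using hd[of p a "0 - b"] hd[of p 0 b] h0 by simp
  have sdz: "?sc n S ((singular_subdivision n ^^ m) z)"
  proof -
    have "(singular_subdivision n ^^ m) z = z + chain_boundary (Suc n) (h n z) + h (n - Suc 0) (chain_boundary n z)"
      using hb[OF z] by (simp add: algebra_simps)
    moreover have "?sc n S (h (n - Suc 0) (chain_boundary n z))"
    proof (cases n)
      case 0 then show ?thesis by (simp add: chain_boundary_def h0)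
    next
      case (Suc k) then show ?thesis using hs[OF singular_chain_boundary[OF z]] by simp
    qed
    ultimately show ?thesis using z hs[OF z] by (metis singular_chain_add singular_chain_boundary_alt)
  qed
  have "Poly_Mapping.keys ((singular_subdivision n ^^ m) z)
     \<subseteq> singular_simplex_set n (subtopology ?P A) \<union> singular_simplex_set n (subtopology ?P B)"
  proof
    fix f assume f: "f \<in> Poly_Mapping.keys ((singular_subdivision n ^^ m) z)"
    then have "singular_simplex n ?P f" using sdz
      by (auto simp: singular_chain_def singular_simplex_subtopology)
    moreover have "f ` standard_simplex n \<subseteq> A \<or> f ` standard_simplex n \<subseteq> B" using m[OF f] UB by blast
    ultimately show "f \<in> singular_simplex_set n (subtopology ?P A) \<union> singular_simplex_set n (subtopology ?P B)"
      by (auto simp: singular_simplex_subtopology)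
  qed
  then obtain a b where ab: "?sc n A a" "?sc n B b" "a + b = (singular_subdivision n ^^ m) z"
    unfolding singular_chain_def by (rule frag_split)
  have scD: "?sc k A d" if "affine_chain_in k D d" for k d
    using affine_chain_in_imp_singular_chain[OF D that] DA by (rule singular_chain_mono)
  have scE: "?sc k B d" if "affine_chain_in k E d" for k d
    using affine_chain_in_imp_singular_chain[OF E that] EB by (rule singular_chain_mono)
  have hcD: "?sc n A (h (n - 1) cD)" and hcE: "?sc n B (h (n - 1) cE)"
    using hs[OF scD[OF c(1)]] hs[OF scE[OF c(2)]] c(4) h0 by (cases n; simp)+
  \<comment> \<open>The homotopy between \<open>z\<close> and its subdivision respects subspaces, so its error terms can be absorbed.\<close>
  define a' where "a' = a - h (n - 1) cD"
  define b' where "b' = b - h (n - 1) cE"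
  have a': "?sc n A a'" and b': "?sc n B b'"
    unfolding a'_def b'_def using ab hcD hcE by (simp_all add: singular_chain_diff)
  have zab: "z = a' + b' - chain_boundary (Suc n) (h n z)"
  proof -
    have "chain_boundary (Suc n) (h n z) + (h (n - 1) cD + h (n - 1) cE) = a + b - z"
      using hb[OF z] c(3) ab(3) ha by simp
    then show ?thesis unfolding a'_def b'_def by (simp add: algebra_simps)
  qed
  have goal: "\<exists>y w. affine_chain_in n (D \<union> E) y \<and> ?sc (Suc n) S w \<and> z = y + chain_boundary (Suc n) w"
    if "affine_chain_in n D yD" "?sc (Suc n) A wA" "affine_chain_in n E yE" "?sc (Suc n) B wB"
      "a' + b' = yD + chain_boundary (Suc n) wA + (yE + chain_boundary (Suc n) wB)" for yD wA yE wB
  proof (intro exI conjI)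
    show "affine_chain_in n (D \<union> E) (yD + yE)"
      using that by (intro affine_chain_in_add) (auto elim: affine_chain_in_mono)
    show "?sc (Suc n) S (wA + wB - h n z)"
      using that AS BS hs[OF z] by (intro singular_chain_add singular_chain_diff) (auto elim: singular_chain_mono)
    show "z = yD + yE + chain_boundary (Suc n) (wA + wB - h n z)"
      unfolding chain_boundary_diff chain_boundary_add using zab that(5) by (simp add: algebra_simps)
  qed
  show "\<exists>y w. affine_chain_in n (D \<union> E) y \<and> ?sc (Suc n) S w \<and> z = y + chain_boundary (Suc n) w"
  proof (cases n)
    case 0
    obtain yD wA where A: "affine_chain_in n D yD" "?sc (Suc n) A wA" "a' = yD + chain_boundary (Suc n) wA"
      using homology_carried_byD[OF hA a'] 0 by blast
    obtain yE wB where B: "affine_chain_in n E yE" "?sc (Suc n) B wB" "b' = yE + chain_boundary (Suc n) wB"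
      using homology_carried_byD[OF hB b'] 0 by blast
    show ?thesis by (rule goal[OF A(1,2) B(1,2)]) (simp add: A(3) B(3))
  next
    case (Suc k)
    have bz: "cD + cE = chain_boundary n a' + chain_boundary n b'"
      using c(3) chain_boundary_boundary_alt[OF hs[OF z]] arg_cong[OF zab, of "chain_boundary n"]
      by (simp add: chain_boundary_diff chain_boundary_add)
    \<comment> \<open>The defect of \<open>a'\<close>; by the boundary of \<open>z\<close> it is the negative of the defect of \<open>b'\<close>.\<close>
    define e where "e = chain_boundary n a' - cD"
    have e2: "e = cE - chain_boundary n b'" unfolding e_def using bz by (simp add: algebra_simps)
    have eA: "?sc k A e" unfolding e_def
      using singular_chain_boundary[OF a'] scD[OF c(1)] Suc by (simp add: singular_chain_diff)
    have eB: "?sc k B e" unfolding e2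
      using singular_chain_boundary[OF b'] scE[OF c(2)] Suc by (simp add: singular_chain_diff)
    have eAB: "?sc k (A \<inter> B) e"
      using eA eB by (auto simp: singular_chain_subtopology)
    have be: "affine_chain_in (k - 1) (D \<inter> E) (chain_boundary k e)" if k0: "0 < k"
    proof (rule affine_chain_in_Int[OF D E])
      obtain j where j: "k = Suc j" using k0 by (cases k) auto
      have 1: "chain_boundary k e = - chain_boundary k cD"
        unfolding e_def chain_boundary_diff using chain_boundary_boundary_alt[OF a'[unfolded Suc]] Suc by simp
      have 2: "chain_boundary k e = chain_boundary k cE"
        unfolding e2 chain_boundary_diff using chain_boundary_boundary_alt[OF b'[unfolded Suc]] Suc by simp
      show "affine_chain_in (k - 1) D (chain_boundary k e)"
        unfolding 1 affine_chain_in_minus using affine_chain_in_boundary[OF D] c(1) Suc j by simp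
      show "affine_chain_in (k - 1) E (chain_boundary k e)"
        unfolding 2 using affine_chain_in_boundary[OF E] c(2) Suc j by simp
    qed
    obtain cL g where L: "affine_chain_in k (D \<inter> E) cL" "?sc (Suc k) (A \<inter> B) g" "e = cL + chain_boundary (Suc k) g"
      using homology_carried_byD[OF hAB eAB be] by blast
    have gA: "?sc n A g" and gB: "?sc n B g" using L(2) Suc by (auto elim: singular_chain_mono)
    have 1: "chain_boundary n (a' - g) = cD + cL"
      unfolding chain_boundary_diff using L(3) Suc by (simp add: e_def algebra_simps)
    have 2: "chain_boundary n (b' + g) = cE - cL"
      unfolding chain_boundary_add using L(3) Suc e2 by (simp add: algebra_simps)
    have cL: "affine_chain_in k D cL" "affine_chain_in k E cL" using L(1) by (auto elim: affine_chain_in_mono)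
    obtain yD wA where A: "affine_chain_in n D yD" "?sc (Suc n) A wA" "a' - g = yD + chain_boundary (Suc n) wA"
    proof (rule homology_carried_byD[OF hA singular_chain_diff[OF a' gA]])
      show "affine_chain_in (n - 1) D (chain_boundary n (a' - g))"
        unfolding 1 using c(1) cL Suc by (simp add: affine_chain_in_add)
    qed
    obtain yE wB where B: "affine_chain_in n E yE" "?sc (Suc n) B wB" "b' + g = yE + chain_boundary (Suc n) wB"
    proof (rule homology_carried_byD[OF hB singular_chain_add[OF b' gB]])
      show "affine_chain_in (n - 1) E (chain_boundary n (b' + g))"
        unfolding 2 using c(2) cL Suc by (simp add: affine_chain_in_diff)
    qed
    show ?thesis
      by (rule goal[OF A(1,2) B(1,2)]) (simp flip: A(3) B(3))
  qed
qed

lemma straight_line_homotopic: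
  fixes f g :: "'x \<Rightarrow> 'v \<Rightarrow> real"
  assumes f: "continuous_map X (powertop_real UNIV) f" and g: "continuous_map X (powertop_real UNIV) g"
    and seg: "\<And>x s. \<lbrakk>x \<in> topspace X; 0 \<le> s; s \<le> 1\<rbrakk> \<Longrightarrow> (\<lambda>v. (1 - s) * f x v + s * g x v) \<in> S"
  shows "homotopic_with (\<lambda>h. True) X (subtopology (powertop_real UNIV) S) f g"
  unfolding homotopic_with_def
proof (intro exI conjI allI ballI)
  let ?h = "\<lambda>(s::real, x). (\<lambda>v. (1 - s) * f x v + s * g x v)"
  let ?I = "prod_topology (subtopology euclideanreal {0..1}) X"
  have c1: "continuous_map ?I euclideanreal fst"
    using continuous_map_fst continuous_map_in_subtopology by blast
  have c2: "continuous_map ?I euclideanreal (\<lambda>z. k (snd z) v)" if "continuous_map X (powertop_real UNIV) k" for k and v :: 'v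
  proof -
    have "continuous_map X euclideanreal (\<lambda>x. k x v)"
      using that unfolding continuous_map_componentwise_UNIV by blast
    from continuous_map_compose[OF continuous_map_snd this] show ?thesis by (simp add: o_def)
  qed
  show "continuous_map ?I (subtopology (powertop_real UNIV) S) ?h"
    unfolding continuous_map_in_subtopology continuous_map_componentwise_UNIV
  proof (intro conjI allI)
    fix v
    show "continuous_map ?I euclideanreal (\<lambda>z. ?h z v)"
      unfolding case_prod_unfold
      by (intro continuous_intros c1 c2 f g)
    show "?h \<in> topspace ?I \<rightarrow> S" using seg by auto
  qed
qed auto

text \<open>
  The straight-line homotopy to a retraction makes the homology of the pair \<open>(S, T)\<close> vanish. A chain of
  \<open>S\<close> whose boundary is affine, and hence lies in \<open>T\<close>, is therefore a chain of \<open>T\<close> up to a boundary.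
\<close>

lemma homology_carried_by_retract:
  fixes K :: "'v::linorder set set"
  assumes TS: "T \<subseteq> S"
    and r: "continuous_map (subtopology (powertop_real UNIV) S) (powertop_real UNIV) r"
    and rT: "\<And>t. t \<in> S \<Longrightarrow> r t \<in> T" and rfix: "\<And>t. t \<in> T \<Longrightarrow> r t = t"
    and seg: "\<And>t s. \<lbrakk>t \<in> S; 0 \<le> s; s \<le> 1\<rbrakk> \<Longrightarrow> (\<lambda>v. (1 - s) * r t v + s * t v) \<in> S"
    and chains: "\<And>n c. affine_chain_in n K c \<Longrightarrow> singular_chain n (subtopology (powertop_real UNIV) T) c"
    and carried: "homology_carried_by T K"
  shows "homology_carried_by S K"
  unfolding homology_carried_by_def
proof (intro allI impI)
  let ?P = "powertop_real (UNIV :: 'v set)"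
  let ?sc = "\<lambda>n T. singular_chain n (subtopology ?P T)"
  fix n z
  assume asm: "?sc n S z \<and> (0 < n \<longrightarrow> affine_chain_in (n - 1) K (chain_boundary n z))"
  have sub: "subtopology (subtopology ?P S) T = subtopology ?P T"
    using TS by (simp add: subtopology_subtopology inf_absorb2)
  have "trivial_group (relative_homology_group (int n) (subtopology ?P S) T)"
  proof (rule trivial_relative_homology_group_gen)
    show c: "continuous_map (subtopology ?P S) (subtopology (subtopology ?P S) T) r"
      unfolding sub continuous_map_in_subtopology using r rT by auto
    show "homotopic_with (\<lambda>h. True) (subtopology (subtopology ?P S) T) (subtopology (subtopology ?P S) T) r id"
    proof (rule homotopic_with_equal)
      show "continuous_map (subtopology (subtopology ?P S) T) (subtopology (subtopology ?P S) T) r"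
        using c continuous_map_from_subtopology by blast
    qed (use rfix in auto)
    show "homotopic_with (\<lambda>k. True) (subtopology ?P S) (subtopology ?P S) r id"
      by (rule straight_line_homotopic) (use r seg in auto)
  qed
  moreover have "singular_relcycle n (subtopology ?P S) T z"
  proof -
    have "?sc (n - 1) T (chain_boundary n z)"
    proof (cases n)
      case 0 then show ?thesis by (simp add: chain_boundary_def)
    next
      case (Suc k) then show ?thesis using asm chains by simp
    qed
    then show ?thesis using asm sub by (simp add: singular_relcycle)
  qed
  ultimately have "singular_relboundary n (subtopology ?P S) T z"
  proof -
    have "homologous_rel_set n (subtopology ?P S) T z \<in> carrier (relative_homology_group (int n) (subtopology ?P S) T)"
      using \<open>singular_relcycle n (subtopology ?P S) T z\<close> unfolding carrier_relative_homology_group by blast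
    then have "homologous_rel_set n (subtopology ?P S) T z = singular_relboundary_set n (subtopology ?P S) T"
      using \<open>trivial_group _\<close> unfolding trivial_group_def by simp
    then show ?thesis by (simp add: homologous_rel_set_eq_relboundary)
  qed
  then obtain w d where w: "?sc (Suc n) S w" and d: "?sc n T d" and zd: "chain_boundary (Suc n) w + d = z"
    unfolding singular_relboundary sub by blast
  have "chain_boundary n z = chain_boundary n d"
    using chain_boundary_boundary_alt[OF w] zd by (metis add_0 chain_boundary_add)
  then have bd: "0 < n \<Longrightarrow> affine_chain_in (n - 1) K (chain_boundary n d)" using asm by simp
  obtain y w' where y: "affine_chain_in n K y" "?sc (Suc n) T w'" "d = y + chain_boundary (Suc n) w'"
    by (rule homology_carried_byD[OF carried d bd])
  show "\<exists>y w. affine_chain_in n K y \<and> ?sc (Suc n) S w \<and> z = y + chain_boundary (Suc n) w"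
  proof (intro exI conjI)
    show "affine_chain_in n K y" by (rule y)
    show "?sc (Suc n) S (w + w')" using w y(2) TS by (intro singular_chain_add) (auto elim: singular_chain_mono)
    show "z = y + chain_boundary (Suc n) (w + w')" using zd y(3) by (simp add: chain_boundary_add algebra_simps)
  qed
qed

lemma realization_set_vertex: "realization_set {{}, {v}} = {vertex_point v}"
proof -
  have "t = vertex_point v" if "t \<in> realization_set {{}, {v}}" for t
  proof -
    have "{u. t u \<noteq> 0} \<subseteq> {v}" using realization_set_support(1)[OF that] by auto
    moreover have "t v = 1" using realization_set_sum[OF that, of "{v}"] calculation by simp
    ultimately show ?thesis by (auto simp: vertex_point_def fun_eq_iff)
  qed
  moreover have "vertex_point v \<in> realization_set {{}, {v}}"
    by (rule realization_setI[of "{v}"]) (auto simp: vertex_point_def)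
  ultimately show ?thesis by blast
qed

lemma finite_complex_vertex: "finite_complex {{}, {v}}"
  by (auto simp: finite_complex_def)

lemma homology_carried_by_vertex: "homology_carried_by {vertex_point v} {{}, {v}}"
  unfolding homology_carried_by_def
proof (intro allI impI)
  let ?X = "subtopology (powertop_real UNIV) {vertex_point v}"
  fix n z
  assume asm: "singular_chain n ?X z \<and> (0 < n \<longrightarrow> affine_chain_in (n - 1) {{}, {v}} (chain_boundary n z))"
  have top: "topspace ?X = {vertex_point v}" by simp
  show "\<exists>y w. affine_chain_in n {{}, {v}} y \<and> singular_chain (Suc n) ?X w \<and> z = y + chain_boundary (Suc n) w"
  proof (cases "n = 0")
    case True
    have "affine_simplex {v} = restrict (\<lambda>x. vertex_point v) (standard_simplex 0)"
      using singular_simplex_affine_simplex[OF finite_complex_vertex[of v], of "{v}" 0]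
        singular_simplex_singleton[OF top] by (simp add: realization_set_vertex)
    then have "affine_chain_in n {{}, {v}} z"
    proof -
      have "Poly_Mapping.keys z \<subseteq> {affine_simplex {v}}"
      proof
        fix f assume "f \<in> Poly_Mapping.keys z"
        then have "singular_simplex 0 ?X f" using asm True by (auto simp: singular_chain_def)
        then show "f \<in> {affine_simplex {v}}"
          unfolding singular_simplex_singleton[OF top] \<open>affine_simplex {v} = _\<close> by simp
      qed
      moreover have "{v} \<in> {J \<in> {{}, {v}}. card J = Suc n}" using True by simp
      ultimately show ?thesis unfolding affine_chain_in_def by blast
    qed
    then show ?thesis by (intro exI[of _ z] exI[of _ 0]) simp
  next
    case False
    have "chain_boundary n z = 0"
    proof (cases "n = 1")
      case True then show ?thesis using chain_boundary_of_singleton[OF top] asm by auto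
    next
      case n1: False
      have none: "{J \<in> {{}, {v}}. card J = Suc (n - 1)} = {}" using False n1 by auto
      have "affine_chain_in (n - 1) {{}, {v}} (chain_boundary n z)" using asm False by simp
      then show ?thesis unfolding affine_chain_in_def none by simp
    qed
    then have "singular_relboundary n ?X {} z"
      using singular_boundary_eq_cycle_singleton[OF top] asm False by (simp add: singular_cycle)
    then obtain d where "singular_chain (Suc n) ?X d" "chain_boundary (Suc n) d = z"
      unfolding singular_boundary by blast
    then have "affine_chain_in n {{}, {v}} 0 \<and> singular_chain (Suc n) ?X d \<and> z = 0 + chain_boundary (Suc n) d"
      by simp
    then show ?thesis by blast
  qed
qed

lemma realization_set_convex:
  assumes K: "finite_complex K" "J \<in> K"
    and t: "t \<in> realization_set L" "{v. t v \<noteq> 0} \<subseteq> J"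
    and u: "u \<in> realization_set M" "{v. u v \<noteq> 0} \<subseteq> J"
    and s: "0 \<le> s" "s \<le> 1"
  shows "(\<lambda>v. (1 - s) * t v + s * u v) \<in> realization_set K"
proof (rule realization_setI[of J])
  show fJ: "finite J" using K by (rule finite_complex_finite)
  show "0 \<le> (1 - s) * t v + s * u v" for v
    using s realization_set_support(2)[OF t(1)] realization_set_support(2)[OF u(1)] by simp
  show 0: "(1 - s) * t v + s * u v = 0" if "v \<notin> J" for v
  proof -
    have "t v = 0" "u v = 0" using that t(2) u(2) by blast+
    then show ?thesis by simp
  qed
  show "{v. (1 - s) * t v + s * u v \<noteq> 0} \<in> K"
    by (rule finite_complex_subset[OF K]) (use 0 in blast)
  show "(\<Sum>v\<in>J. (1 - s) * t v + s * u v) = 1"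
    using realization_set_sum[OF t(1) fJ t(2)] realization_set_sum[OF u(1) fJ u(2)]
    by (simp add: sum.distrib flip: sum_distrib_left)
qed

text \<open>
  The augmentation of singular chains. Its values are multiples of the empty simplex, so that on affine
  0-chains it agrees with the oriented boundary.
\<close>

abbreviation augmentation :: "('b \<Rightarrow>\<^sub>0 int) \<Rightarrow> ('v set \<Rightarrow>\<^sub>0 int)" where
  "augmentation \<equiv> frag_extend (\<lambda>_. frag_of {})"

lemma augmentation_chain_boundary: "augmentation (chain_boundary (Suc 0) w) = 0"
proof -
  have "Poly_Mapping.keys w \<subseteq> UNIV" by simp
  then show ?thesis
    by (induction w rule: frag_induction)
      (simp_all add: chain_boundary_of chain_boundary_diff frag_extend_diff frag_extend_add frag_extend_cmul
        frag_extend_minus del: minus_frag_cmul)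
qed

lemma augmentation_affine_chain:
  assumes "Poly_Mapping.keys x \<subseteq> {J. card J = Suc 0}"
  shows "augmentation (affine_chain x) = oriented_boundary x"
  using assms
proof (induction x rule: frag_induction)
  case (one J)
  then obtain j where J: "J = {j}" by (auto simp: card_Suc_eq)
  have e: "{i \<in> {j}. i < j} = {}" by auto
  have "face_boundary {j} = frag_cmul ((- 1) ^ card {i \<in> {j}. i < j}) (frag_of ({j} - {j}))"
    unfolding face_boundary_def by simp
  then have "face_boundary {j} = frag_of {}" unfolding e by simp
  then show ?case unfolding J by (simp add: affine_chain_def oriented_boundary_def)
next
  case (diff a b)
  then show ?case by (simp add: affine_chain_def oriented_boundary_def frag_extend_diff)
qed (simp add: affine_chain_def oriented_boundary_def)

text \<open>
  An affine chain that bounds a singular chain is a cycle of the augmented oriented complex. In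
  degree 0, where the singular boundary carries no information, this is because the augmentation
  vanishes on boundaries.
\<close>

lemma oriented_boundary_eq_0:
  assumes K: "finite_complex K" and x: "Poly_Mapping.keys x \<subseteq> {J \<in> K. card J = Suc n}"
    and w: "singular_chain (Suc n) X w" "affine_chain x = chain_boundary (Suc n) w"
  shows "oriented_boundary x = 0"
proof (cases n)
  case 0
  have "Poly_Mapping.keys x \<subseteq> {J. card J = Suc 0}" using x 0 by auto
  then show ?thesis using augmentation_affine_chain w(2) augmentation_chain_boundary 0 by metis
next
  case (Suc k)
  have "affine_chain (oriented_boundary x) = chain_boundary (Suc k) (affine_chain x)"
    by (rule chain_boundary_affine_chain[symmetric]) (use x finite_complex_faces[OF K] Suc in blast)
  also have "\<dots> = 0" using chain_boundary_boundary_alt[OF w(1)] w(2) Suc by simp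
  finally show ?thesis
    by (intro affine_chain_eq_0[of "oriented_boundary x" k]
        subset_trans[OF keys_oriented_boundary[OF K x] finite_complex_faces[OF K], unfolded Suc])
qed

text \<open>
  The closed star of \<open>v\<close> is a cone with apex \<open>v\<close>, both as a space and as a complex. Coning produces an
  affine chain with the same boundary as \<open>z\<close>; the difference is a cycle, to which the contraction
  of the space to the point \<open>v\<close> applies.
\<close>

lemma homology_carried_by_star:
  fixes E :: "'v::linorder set set"
  assumes E: "finite_complex E" and star: "\<And>J. J \<in> E \<Longrightarrow> insert v J \<in> E"
    and least: "\<And>j. j \<in> \<Union>E \<Longrightarrow> v \<le> j"
  shows "homology_carried_by (realization_set E) E"
  unfolding homology_carried_by_def
proof (intro allI impI)
  let ?P = "powertop_real (UNIV :: 'v set)"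
  let ?S = "realization_set E"
  let ?sc = "\<lambda>n T. singular_chain n (subtopology ?P T)"
  have empE: "{} \<in> E" using E by (simp add: finite_complex_def)
  have v: "{v} \<in> E" using star[OF empE] .
  have vE: "{{}, {v}} \<subseteq> E" using v empE by simp
  have vp: "vertex_point v \<in> ?S"
    by (rule realization_setI[of "{v}"]) (use v in \<open>auto simp: vertex_point_def\<close>)
  have cone: "homology_carried_by ?S {{}, {v}}"
  proof (rule homology_carried_by_retract[of "{vertex_point v}" _ "\<lambda>_. vertex_point v"])
    show "{vertex_point v} \<subseteq> ?S" using vp by simp
    show "(\<lambda>u. (1 - s) * vertex_point v u + s * t u) \<in> ?S" if "t \<in> ?S" "0 \<le> s" "s \<le> 1" for t s
    proof (rule realization_set_convex[OF E star[OF realization_set_support(1)[OF that(1)]] vp _ that(1) _ that(2,3)])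
    qed (auto simp: vertex_point_def)
    show "?sc n {vertex_point v} c" if "affine_chain_in n {{}, {v}} c" for n c
      using affine_chain_in_imp_singular_chain[OF finite_complex_vertex that] by (simp add: realization_set_vertex)
  qed (auto simp: homology_carried_by_vertex)
  fix n z
  assume asm: "?sc n ?S z \<and> (0 < n \<longrightarrow> affine_chain_in (n - 1) E (chain_boundary n z))"
  have "\<exists>c. affine_chain_in n E c \<and> (0 < n \<longrightarrow> chain_boundary n c = chain_boundary n z)"
  proof (cases n)
    case 0
    then show ?thesis by (intro exI[of _ 0]) simp
  next
    case (Suc k)
    then have "affine_chain_in k E (chain_boundary n z)" using asm by simp
    then obtain x where x: "Poly_Mapping.keys x \<subseteq> {J \<in> E. card J = Suc k}" "chain_boundary n z = affine_chain x"
      by (rule affine_chain_inE)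
    \<comment> \<open>\<open>x\<close> is a cycle because its affine chain is the boundary of \<open>z\<close>.\<close>
    have dx: "oriented_boundary x = 0"
      by (rule oriented_boundary_eq_0[OF E x(1), of "subtopology ?P ?S" z]) (use asm x(2) Suc in simp_all)
    let ?y = "frag_extend (cone_face v) x"
    have "oriented_boundary ?y + frag_extend (cone_face v) (oriented_boundary x) = x"
    proof (rule cone_oriented_boundary)
      show "finite J \<and> (\<forall>j\<in>J. v \<le> j)" if "J \<in> Poly_Mapping.keys x" for J
        using that x(1) least finite_complex_finite[OF E] by blast
    qed
    then have y: "oriented_boundary ?y = x" using dx by simp
    have ky: "Poly_Mapping.keys ?y \<subseteq> {J \<in> E. card J = Suc (Suc k)}"
    proof (rule subset_trans[OF keys_frag_extend], rule UN_least)
      fix J assume "J \<in> Poly_Mapping.keys x"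
      then have "J \<in> E" "card J = Suc k" "finite J" using x(1) finite_complex_finite[OF E] by auto
      then show "Poly_Mapping.keys (cone_face v J) \<subseteq> {J \<in> E. card J = Suc (Suc k)}"
        using star[of J] by (auto simp: cone_face_def)
    qed
    have "chain_boundary n (affine_chain ?y) = affine_chain x"
      unfolding Suc chain_boundary_affine_chain[OF subset_trans[OF ky finite_complex_faces[OF E]]] y ..
    then show ?thesis using x(2) affine_chain_in_affine_chain[OF ky] Suc by (intro exI[of _ "affine_chain ?y"]) simp
  qed
  then obtain c where c: "affine_chain_in n E c" "0 < n \<Longrightarrow> chain_boundary n c = chain_boundary n z" by blast
  have zc: "?sc n ?S (z - c)" using asm affine_chain_in_imp_singular_chain[OF E c(1)] by (simp add: singular_chain_diff)
  have bzc: "affine_chain_in (n - 1) {{}, {v}} (chain_boundary n (z - c))" if "0 < n"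
    using c(2)[OF that] by (simp add: chain_boundary_diff)
  obtain y w where y: "affine_chain_in n {{}, {v}} y" "?sc (Suc n) ?S w" "z - c = y + chain_boundary (Suc n) w"
    by (rule homology_carried_byD[OF cone zc bzc])
  show "\<exists>y w. affine_chain_in n E y \<and> ?sc (Suc n) ?S w \<and> z = y + chain_boundary (Suc n) w"
  proof (intro exI conjI)
    show "affine_chain_in n E (c + y)" using c(1) affine_chain_in_mono[OF y(1) vE] by (rule affine_chain_in_add)
    show "z = c + y + chain_boundary (Suc n) w" using y(3) by (simp add: algebra_simps)
  qed (rule y)
qed

text \<open>
  Away from the vertex \<open>v\<close>, deleting the coordinate of \<open>v\<close> and rescaling is a retraction onto the
  subcomplex of the simplices that avoid \<open>v\<close>, and it never leaves the simplex at hand.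
\<close>

lemma homology_carried_by_punctured:
  fixes M :: "'v::linorder set set" and v :: 'v
  defines "D \<equiv> {J \<in> M. v \<notin> J}"
  assumes M: "finite_complex M" and carried: "homology_carried_by (realization_set D) D"
  shows "homology_carried_by {t \<in> realization_set M. t v < 1} D"
proof -
  let ?P = "powertop_real (UNIV :: 'v set)"
  let ?S = "{t \<in> realization_set M. t v < 1}"
  let ?r = "\<lambda>t u. if u = v then 0 else t u / (1 - t v)"
  have D: "finite_complex D"
    using M unfolding finite_complex_def D_def by (auto intro: finite_subset[of _ "\<Union>M"])
  have Dv: "t v = 0" if "t \<in> realization_set D" for t
    using realization_set_support(1)[OF that] by (auto simp: D_def)
  have DM: "realization_set D \<subseteq> realization_set M" by (auto simp: realization_set_def D_def)
  have rD: "?r t \<in> realization_set D" if t: "t \<in> ?S" for t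
  proof -
    have tM: "t \<in> realization_set M" and t1: "t v < 1" using t by auto
    let ?J = "{u. t u \<noteq> 0} - {v}"
    have J: "{u. t u \<noteq> 0} \<in> M" "finite {u. t u \<noteq> 0}"
      using realization_set_support(1)[OF tM] finite_complex_finite[OF M] by auto
    show ?thesis
    proof (rule realization_setI[of ?J])
      show "finite ?J" using J by simp
      show "0 \<le> ?r t u" for u using realization_set_support(2)[OF tM] t1 by simp
      show "?r t u = 0" if "u \<notin> ?J" for u using that by auto
      have "{u. ?r t u \<noteq> 0} = ?J" using t1 by auto
      moreover have "?J \<in> M" by (rule finite_complex_subset[OF M J(1)]) auto
      ultimately show "{u. ?r t u \<noteq> 0} \<in> D" by (simp add: D_def)
      have "(\<Sum>u\<in>insert v {u. t u \<noteq> 0}. t u) = 1" by (rule realization_set_sum[OF tM]) (use J in auto)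
      then have "t v + (\<Sum>u\<in>?J. t u) = 1" using J by (simp add: sum.insert_remove)
      then have "(\<Sum>u\<in>?J. t u) = 1 - t v" by linarith
      moreover have "(\<Sum>u\<in>?J. ?r t u) = (\<Sum>u\<in>?J. t u) / (1 - t v)"
        unfolding sum_divide_distrib by (rule sum.cong) auto
      ultimately show "(\<Sum>u\<in>?J. ?r t u) = 1" using t1 by simp
    qed
  qed
  show ?thesis
  proof (rule homology_carried_by_retract[of "realization_set D" _ ?r])
    show "realization_set D \<subseteq> ?S"
    proof
      fix t assume t: "t \<in> realization_set D"
      then show "t \<in> ?S" using DM Dv[OF t] by auto
    qed
    show "continuous_map (subtopology ?P ?S) ?P ?r"
      unfolding continuous_map_componentwise_UNIV
    proof
      fix u
      show "continuous_map (subtopology ?P ?S) euclideanreal (\<lambda>t. ?r t u)"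
      proof (cases "u = v")
        case False
        have "continuous_map (subtopology ?P ?S) euclideanreal (\<lambda>t. t u / (1 - t v))"
          by (intro continuous_intros continuous_map_from_subtopology[OF continuous_map_product_projection]) auto
        then show ?thesis using False by simp
      qed simp
    qed
    show "?r t \<in> realization_set D" if "t \<in> ?S" for t using rD that .
    show "?r t = t" if "t \<in> realization_set D" for t using Dv[OF that] by (auto simp: fun_eq_iff)
    show "(\<lambda>u. (1 - s) * ?r t u + s * t u) \<in> ?S" if t: "t \<in> ?S" and s: "0 \<le> s" "s \<le> 1" for t s
    proof -
      have tM: "t \<in> realization_set M" and t1: "t v < 1" using t by auto
      have "(\<lambda>u. (1 - s) * ?r t u + s * t u) \<in> realization_set M"
        by (rule realization_set_convex[OF M realization_set_support(1)[OF tM] rD[OF t] _ tM _ s]) auto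
      moreover have "s * t v < 1"
        using mult_left_le_one_le[OF realization_set_support(2)[OF tM, of v] s] t1 by linarith
      ultimately show ?thesis by simp
    qed
    show "singular_chain n (subtopology ?P (realization_set D)) c" if "affine_chain_in n D c" for n c
      using affine_chain_in_imp_singular_chain[OF D that] .
  qed (rule carried)
qed

text \<open>
  Induction on the number of vertices. With \<open>v\<close> the smallest vertex, \<open>D\<close> the simplices avoiding \<open>v\<close> and
  \<open>E\<close> the closed star of \<open>v\<close>, the realization is covered by the complement of the point \<open>v\<close>, which
  retracts onto \<open>D\<close>, and by the star, whose part away from \<open>v\<close> retracts onto the link \<open>D \<inter> E\<close>. Both
  \<open>D\<close> and the link lack the vertex \<open>v\<close>.
\<close>

theorem homology_carried_by_simplices:
  fixes K :: "'v::linorder set set"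
  assumes "finite_complex K"
  shows "homology_carried_by (realization_set K) K"
  using assms
proof (induction "card (\<Union>K)" arbitrary: K rule: less_induct)
  case (less K)
  let ?P = "powertop_real (UNIV :: 'v set)"
  note K = less.prems
  have finK: "finite (\<Union>K)" using K by (simp add: finite_complex_def)
  show ?case
  proof (cases "\<Union>K = {}")
    case True
    then have "realization_set K = {}"
      using realization_set_support(1) realization_set_sum[of _ K "{}"] by force
    then show ?thesis
      unfolding homology_carried_by_def
      by (auto simp: singular_chain_empty intro!: exI[of _ 0])
  next
    case False
    define v where "v = Min (\<Union>K)"
    have v: "v \<in> \<Union>K" "\<And>j. j \<in> \<Union>K \<Longrightarrow> v \<le> j" using Min_in[OF finK False] Min_le[OF finK] unfolding v_def by blast+
    define D where "D = {J \<in> K. v \<notin> J}"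
    define E where "E = {J \<in> K. insert v J \<in> K}"
    let ?A = "{t \<in> realization_set K. t v < 1}" and ?U = "{t \<in> realization_set K. 0 < t v}"
    have D: "finite_complex D"
      using K unfolding finite_complex_def D_def by (auto intro: finite_subset[of _ "\<Union>K"])
    have vK: "{v} \<in> K" using v(1) finite_complex_subset[OF K] by auto
    have E: "finite_complex E"
      unfolding finite_complex_def
    proof (intro conjI ballI allI impI)
      show "{} \<in> E" using vK K by (simp add: E_def finite_complex_def)
      show "finite (\<Union>E)" by (rule finite_subset[OF _ finK]) (auto simp: E_def)
      fix J I assume "J \<in> E" "I \<subseteq> J"
      then show "I \<in> E" using finite_complex_subset[OF K] unfolding E_def by (blast intro: insert_mono)
    qed
    have DE: "D \<inter> E = {J \<in> E. v \<notin> J}" by (auto simp: D_def E_def)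
    have L: "finite_complex (D \<inter> E)"
      using D E unfolding finite_complex_def by (auto intro: finite_subset[of _ "\<Union>D"])
    have KDE: "K = D \<union> E" by (auto simp: D_def E_def insert_absorb)
    have smaller: "card (\<Union>D) < card (\<Union>K)" "card (\<Union>(D \<inter> E)) < card (\<Union>K)"
      using v(1) by (intro psubset_card_mono finK psubsetI; force simp: D_def)+
    have hD: "homology_carried_by ?A D"
      using homology_carried_by_punctured[OF K, of v] less.hyps[OF smaller(1) D] by (simp add: D_def)
    have hE: "homology_carried_by (realization_set E) E"
    proof (rule homology_carried_by_star[OF E])
      show "insert v J \<in> E" if "J \<in> E" for J using that by (simp add: E_def)
      show "v \<le> j" if "j \<in> \<Union>E" for j using that v(2) by (auto simp: E_def)
    qed
    have AB: "?A \<inter> realization_set E = {t \<in> realization_set E. t v < 1}"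
      by (auto simp: realization_set_def E_def)
    have hL: "homology_carried_by (?A \<inter> realization_set E) (D \<inter> E)"
      unfolding AB using homology_carried_by_punctured[OF E, of v] less.hyps[OF smaller(2) L] by (simp add: DE)
    have proj: "continuous_map (subtopology ?P (realization_set K)) euclideanreal (\<lambda>t. t v)"
      by (intro continuous_map_from_subtopology continuous_map_product_projection) simp
    show ?thesis
      unfolding KDE
    proof (rule homology_carried_by_glue[where A = ?A and B = "realization_set E" and U = ?U, OF D E])
      show "realization_set D \<subseteq> ?A"
        by (auto simp: realization_set_def D_def)
      show "?A \<subseteq> realization_set (D \<union> E)" "realization_set E \<subseteq> realization_set (D \<union> E)"
        using KDE by (auto simp: realization_set_def)
      have "openin (subtopology ?P (realization_set K)) {t \<in> topspace (subtopology ?P (realization_set K)). t v \<in> {..<1}}"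
        by (rule openin_continuous_map_preimage[OF proj]) auto
      then show "openin (subtopology ?P (realization_set (D \<union> E))) ?A" by (simp flip: KDE)
      have "openin (subtopology ?P (realization_set K)) {t \<in> topspace (subtopology ?P (realization_set K)). t v \<in> {0<..}}"
        by (rule openin_continuous_map_preimage[OF proj]) auto
      then show "openin (subtopology ?P (realization_set (D \<union> E))) ?U" by (simp flip: KDE)
      show "?U \<subseteq> realization_set E"
      proof
        fix t assume t: "t \<in> ?U"
        then have "insert v {u. t u \<noteq> 0} = {u. t u \<noteq> 0}" by auto
        then show "t \<in> realization_set E" using t by (auto simp: realization_set_def E_def)
      qed
      show "realization_set (D \<union> E) \<subseteq> ?A \<union> ?U" unfolding KDE[symmetric] by force
    qed (use hD hE hL in auto)
  qed
qed

section \<open>The conormal complex in coordinates\<close>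

definition index_complex :: "'a corner_data \<Rightarrow> nat set set" where
  "index_complex X = {J. J \<subseteq> {1..num_bdf X} \<and> corner_face X J \<noteq> {}}"

lemma corner_face_antimono: "I \<subseteq> J \<Longrightarrow> corner_face X J \<subseteq> corner_face X I"
  by (auto simp: corner_face_def hyperface_def split: if_splits)

lemma finite_complex_index_complex:
  assumes "corner_space X \<noteq> {}"
  shows "finite_complex (index_complex X)"
  unfolding finite_complex_def
proof (intro conjI ballI allI impI)
  show "{} \<in> index_complex X" using assms by (simp add: index_complex_def corner_face_def)
  show "finite (\<Union>(index_complex X))"
    by (rule finite_subset[of _ "{1..num_bdf X}"]) (auto simp: index_complex_def)
  show "I \<in> index_complex X" if "J \<in> index_complex X" "I \<subseteq> J" for I J
    using that corner_face_antimono[OF that(2), of X] by (auto simp: index_complex_def)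
qed

abbreviation faces :: "'a corner_data \<Rightarrow> int \<Rightarrow> nat set set" where
  "faces X p \<equiv> {J \<in> index_complex X. int (card J) = p}"

lemma conormal_symbols_iff:
  "(f, s, js) \<in> conormal_symbols X p \<longleftrightarrow>
     f = corner_face X (set js) \<and> (s = 1 \<or> s = - 1) \<and> distinct js \<and> set js \<in> faces X p"
  by (auto simp: conormal_symbols_def index_complex_def faces_of_codim_def distinct_card)

text \<open>
  The coordinate of a conormal symbol once each conormal bundle is oriented by the increasing order of
  the indices.
\<close>

definition symbol_value :: "'a conormal_symbol \<Rightarrow> (nat set \<Rightarrow>\<^sub>0 int)" where
  "symbol_value = (\<lambda>(f, s, js). frag_cmul (s * list_sign js) (frag_of (set js)))"

abbreviation chain_value :: "('a conormal_symbol \<Rightarrow>\<^sub>0 int) \<Rightarrow> (nat set \<Rightarrow>\<^sub>0 int)" where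
  "chain_value \<equiv> frag_extend symbol_value"

definition standard_symbol :: "'a corner_data \<Rightarrow> nat set \<Rightarrow> 'a conormal_symbol" where
  "standard_symbol X J = (corner_face X J, 1, sorted_list_of_set J)"

abbreviation standard_chain :: "'a corner_data \<Rightarrow> (nat set \<Rightarrow>\<^sub>0 int) \<Rightarrow> ('a conormal_symbol \<Rightarrow>\<^sub>0 int)" where
  "standard_chain X \<equiv> frag_extend (frag_of \<circ> standard_symbol X)"

lemma finite_faces: "J \<in> faces X p \<Longrightarrow> finite J"
  by (auto simp: index_complex_def intro: finite_subset)

lemma keys_chain_value:
  assumes "Poly_Mapping.keys x \<subseteq> conormal_symbols X p"
  shows "Poly_Mapping.keys (chain_value x) \<subseteq> faces X p"
proof (rule subset_trans[OF keys_frag_extend], rule UN_least)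
  fix \<sigma> assume "\<sigma> \<in> Poly_Mapping.keys x"
  then have "\<sigma> \<in> conormal_symbols X p" using assms by blast
  then show "Poly_Mapping.keys (symbol_value \<sigma>) \<subseteq> faces X p"
    by (cases \<sigma>) (auto simp: symbol_value_def conormal_symbols_iff)
qed

lemma standard_symbol_in: "J \<in> faces X p \<Longrightarrow> standard_symbol X J \<in> conormal_symbols X p"
  using finite_faces[of J X p] by (simp add: standard_symbol_def conormal_symbols_iff)

lemma keys_standard_chain:
  assumes "Poly_Mapping.keys u \<subseteq> faces X p"
  shows "Poly_Mapping.keys (standard_chain X u) \<subseteq> conormal_symbols X p"
proof (rule subset_trans[OF keys_frag_extend], rule UN_least)
  fix J assume "J \<in> Poly_Mapping.keys u"
  then have "J \<in> faces X p" using assms by blast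
  then show "Poly_Mapping.keys ((frag_of \<circ> standard_symbol X) J) \<subseteq> conormal_symbols X p"
    by (simp only: o_apply keys_frag_of) (simp only: standard_symbol_in empty_subsetI insert_subset)
qed

lemma chain_value_standard_chain:
  assumes "Poly_Mapping.keys u \<subseteq> faces X p"
  shows "chain_value (standard_chain X u) = u"
  using assms
proof (induction u rule: frag_induction)
  case (one J)
  have "finite J" using finite_faces one by blast
  then show ?case by (simp add: standard_symbol_def symbol_value_def list_sign_sorted)
qed (simp_all add: frag_extend_diff)

lemma keys_symbol_boundary:
  assumes X: "corner_space X \<noteq> {}" and \<sigma>: "\<sigma> \<in> conormal_symbols X p"
  shows "Poly_Mapping.keys (symbol_boundary X \<sigma>) \<subseteq> conormal_symbols X (p - 1)"
proof -
  obtain f s js where \<sigma>_eq: "\<sigma> = (f, s, js)" by (cases \<sigma>)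
  then have js: "s = 1 \<or> s = - 1" "distinct js" "set js \<in> index_complex X" "int (length js) = p"
    using \<sigma> by (auto simp: conormal_symbols_iff distinct_card)
  have "(corner_face X (set (delete_nth i js)), s, delete_nth i js) \<in> conormal_symbols X (p - 1)"
    if i: "i < length js" for i
  proof -
    have "distinct (take i js @ js ! i # drop (Suc i) js)"
      using js(2) by (subst id_take_nth_drop[OF i, symmetric])
    then have d: "distinct (delete_nth i js)" by auto
    have "set (delete_nth i js) \<in> index_complex X"
      by (rule finite_complex_subset[OF finite_complex_index_complex[OF X] js(3)])
        (simp only: set_delete_nth[OF js(2) i] Diff_subset)
    moreover have "int (card (set (delete_nth i js))) = p - 1"
      unfolding distinct_card[OF d] using i js(4) by auto
    ultimately show ?thesis using js(1) d by (simp add: conormal_symbols_iff del: set_append)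
  qed
  then show ?thesis
    unfolding symbol_boundary_def \<sigma>_eq Let_def case_prod_conv
    by (intro subset_trans[OF keys_sum] UN_least subset_trans[OF keys_cmul]) (auto simp del: set_append)
qed

text \<open>
  Contraction in the list order and the boundary in the increasing order differ in each term by
  the same sign, namely by the sign of the list.
\<close>

lemma chain_value_symbol_boundary:
  assumes "distinct js"
  shows "chain_value (symbol_boundary X (f, s, js)) = oriented_boundary (symbol_value (f, s, js))"
proof -
  have "chain_value (symbol_boundary X (f, s, js))
      = (\<Sum>i<length js. frag_cmul ((- 1) ^ i * (s * list_sign (delete_nth i js))) (frag_of (set (delete_nth i js))))"
    by (simp add: symbol_boundary_def Let_def frag_extend_sum frag_extend_cmul symbol_value_def o_def
        del: set_append)
  also have "\<dots> = (\<Sum>i<length js. frag_cmul (s * list_sign js)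
      (frag_cmul ((- 1) ^ card {y \<in> set js. y < js ! i}) (frag_of (set js - {js ! i}))))"
  proof (rule sum.cong[OF refl])
    fix i assume "i \<in> {..<length js}"
    then have i: "i < length js" by simp
    have "(- 1) ^ i * (s * list_sign (delete_nth i js)) = s * ((- 1) ^ i * list_sign (delete_nth i js))"
      by (rule mult.left_commute)
    also have "\<dots> = s * list_sign js * (- 1) ^ card {y \<in> set js. y < js ! i}"
      unfolding list_sign_delete_nth[OF assms i] by (simp only: mult_ac)
    finally have sg: "(- 1) ^ i * (s * list_sign (delete_nth i js)) = s * list_sign js * (- 1) ^ card {y \<in> set js. y < js ! i}" .
    show "frag_cmul ((- 1) ^ i * (s * list_sign (delete_nth i js))) (frag_of (set (delete_nth i js)))
      = frag_cmul (s * list_sign js) (frag_cmul ((- 1) ^ card {y \<in> set js. y < js ! i}) (frag_of (set js - {js ! i})))"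
      unfolding sg set_delete_nth[OF assms i] frag_cmul_cmul ..
  qed
  also have "\<dots> = (\<Sum>j\<in>set js. frag_cmul (s * list_sign js)
      (frag_cmul ((- 1) ^ card {y \<in> set js. y < j}) (frag_of (set js - {j}))))"
    by (rule sum.reindex_bij_betw[OF bij_betw_nth[OF assms refl refl]])
  also have "\<dots> = frag_cmul (s * list_sign js) (face_boundary (set js))"
    unfolding face_boundary_def frag_cmul_sum ..
  also have "\<dots> = oriented_boundary (symbol_value (f, s, js))"
    by (simp add: symbol_value_def oriented_boundary_def frag_extend_cmul)
  finally show ?thesis .
qed

lemma chain_value_boundary:
  assumes "Poly_Mapping.keys x \<subseteq> conormal_symbols X p"
  shows "chain_value (frag_extend (symbol_boundary X) x) = oriented_boundary (chain_value x)"
  using assms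
proof (induction x rule: frag_induction)
  case (one \<sigma>)
  then show ?case
    using chain_value_symbol_boundary[of "snd (snd \<sigma>)" X "fst \<sigma>" "fst (snd \<sigma>)"]
    by (cases \<sigma>) (simp add: conormal_symbols_iff)
next
  case (diff a b)
  then show ?case unfolding oriented_boundary_def frag_extend_diff by (simp only:)
qed (simp add: oriented_boundary_def)

lemma keys_boundary_chain:
  assumes "corner_space X \<noteq> {}" "Poly_Mapping.keys x \<subseteq> conormal_symbols X p"
  shows "Poly_Mapping.keys (frag_extend (symbol_boundary X) x) \<subseteq> conormal_symbols X (p - 1)"
proof (rule subset_trans[OF keys_frag_extend], rule UN_least)
  fix \<sigma> assume "\<sigma> \<in> Poly_Mapping.keys x"
  then have "\<sigma> \<in> conormal_symbols X p" using assms(2) by blast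
  then show "Poly_Mapping.keys (symbol_boundary X \<sigma>) \<subseteq> conormal_symbols X (p - 1)"
    by (rule keys_symbol_boundary[OF assms(1)])
qed

text \<open>
  Modulo the relations, every symbol is a multiple of the standard symbol of its face: a permutation
  relation sorts the list and a sign relation normalizes the coefficient. So a chain all of whose
  coordinates vanish is itself a combination of relations.
\<close>

lemma conormal_relations_eq:
  "conormal_relations X p = {x. Poly_Mapping.keys x \<subseteq> conormal_symbols X p \<and> chain_value x = 0}"
    (is "_ = ?Ker")
proof
  let ?G = "free_Abelian_group (conormal_symbols X p)"
  let ?N = "{frag_of (f, - s, js) + frag_of (f, s, js) | f s js. (f, s, js) \<in> conormal_symbols X p}"
  let ?O = "{frag_of (f, sign \<pi> * s, permute_list \<pi> js) - frag_of (f, s, js) | f s js \<pi>.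
           (f, s, js) \<in> conormal_symbols X p \<and> \<pi> permutes {..<length js}}"
  have R: "conormal_relations X p = generate ?G (?N \<union> ?O)"
    by (simp add: conormal_relations_def)
  have perm: "(f, sign \<pi> * s, permute_list \<pi> js) \<in> conormal_symbols X p"
    if "(f, s, js) \<in> conormal_symbols X p" "\<pi> permutes {..<length js}" for f s js and \<pi> :: "nat \<Rightarrow> nat"
  proof -
    have s: "s = 1 \<or> s = - 1" using that(1) by (simp add: conormal_symbols_iff)
    have "sign \<pi> * s = 1 \<or> sign \<pi> * s = - 1"
      using s by (cases \<pi> rule: sign_cases) auto
    then show ?thesis using that by (simp add: conormal_symbols_iff)
  qed
  have sub: "subgroup ?Ker ?G"
  proof (rule group.subgroupI[OF group_free_Abelian_group])
    show "?Ker \<subseteq> carrier ?G" by auto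
    have "0 \<in> ?Ker" by simp
    then show "?Ker \<noteq> {}" by blast
    show "inv\<^bsub>?G\<^esub> a \<in> ?Ker" if "a \<in> ?Ker" for a using that by (simp add: frag_extend_minus)
    show "a \<otimes>\<^bsub>?G\<^esub> b \<in> ?Ker" if "a \<in> ?Ker" "b \<in> ?Ker" for a b
      using that keys_add[of a b] by (auto simp: frag_extend_add)
  qed
  have gens: "?N \<union> ?O \<subseteq> ?Ker"
  proof
    fix r assume "r \<in> ?N \<union> ?O"
    then consider (N) f s js where "r = frag_of (f, - s, js) + frag_of (f, s, js)" "(f, s, js) \<in> conormal_symbols X p"
      | (O) f s js \<pi> where "r = frag_of (f, sign \<pi> * s, permute_list \<pi> js) - frag_of (f, s, js)"
         "(f, s, js) \<in> conormal_symbols X p" "\<pi> permutes {..<length js}" by blast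
    then show "r \<in> ?Ker"
    proof cases
      case N
      then have "(f, - s, js) \<in> conormal_symbols X p" by (auto simp: conormal_symbols_iff)
      then have "Poly_Mapping.keys r \<subseteq> conormal_symbols X p"
        unfolding N(1) using N(2) by (intro subset_trans[OF keys_add]) auto
      then show ?thesis unfolding N(1) by (simp add: frag_extend_add symbol_value_def flip: frag_cmul_distrib)
    next
      case O
      have d: "distinct js" using O(2) by (simp add: conormal_symbols_iff)
      have "Poly_Mapping.keys r \<subseteq> conormal_symbols X p"
        unfolding O(1) using O(2) perm[OF O(2,3)] by (intro subset_trans[OF keys_diff]) auto
      moreover have sg: "sign \<pi> * s * (sign \<pi> * list_sign js) = s * list_sign js"
        by (cases \<pi> rule: sign_cases) simp_all
      ultimately show ?thesis
        unfolding O(1) using O(3) by (simp add: frag_extend_diff symbol_value_def list_sign_permute[OF d O(3)] sg)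
    qed
  qed
  then show "conormal_relations X p \<subseteq> ?Ker"
    unfolding R using sub by (rule group.generate_subgroup_incl[OF group_free_Abelian_group])
  have RG: "subgroup (conormal_relations X p) ?G"
    unfolding R
  proof (rule group.generate_is_subgroup[OF group_free_Abelian_group], rule subset_trans[OF gens])
    show "?Ker \<subseteq> carrier ?G" by auto
  qed
  have R0: "0 \<in> conormal_relations X p" using subgroup.one_closed[OF RG] by simp
  have Radd: "a + b \<in> conormal_relations X p" if "a \<in> conormal_relations X p" "b \<in> conormal_relations X p" for a b
    using subgroup.m_closed[OF RG that] by simp
  have Rneg: "- a \<in> conormal_relations X p" if "a \<in> conormal_relations X p" for a
    using subgroup.m_inv_closed[OF RG that] subgroup.mem_carrier[OF RG that] by simp
  have Rdiff: "a - b \<in> conormal_relations X p" if "a \<in> conormal_relations X p" "b \<in> conormal_relations X p" for a b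
    using Radd[OF that(1) Rneg[OF that(2)]] by simp
  have single: "frag_of \<sigma> - standard_chain X (symbol_value \<sigma>) \<in> conormal_relations X p"
    if \<sigma>: "\<sigma> \<in> conormal_symbols X p" for \<sigma>
  proof -
    obtain f s js where \<sigma>_eq: "\<sigma> = (f, s, js)" by (cases \<sigma>)
    let ?ks = "sorted_list_of_set (set js)"
    have sym: "(f, s, js) \<in> conormal_symbols X p" using \<sigma> \<sigma>_eq by simp
    then have js: "f = corner_face X (set js)" "s = 1 \<or> s = - 1" "distinct js" "set js \<in> faces X p"
      by (auto simp: conormal_symbols_iff)
    have "mset ?ks = mset js" using js(3) by (simp add: set_eq_iff_mset_eq_distinct[symmetric])
    then obtain \<pi> where \<pi>: "\<pi> permutes {..<length js}" "permute_list \<pi> js = ?ks"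
      by (rule mset_eq_permutation)
    have "sign \<pi> * list_sign js = 1"
      using list_sign_permute[OF js(3) \<pi>(1)] list_sign_sorted[of ?ks] \<pi>(2) by simp
    then have ls: "list_sign js = sign \<pi>" by (cases \<pi> rule: sign_cases) simp_all
    have rel: "frag_of (f, sign \<pi> * s, ?ks) - frag_of (f, s, js) \<in> conormal_relations X p"
      unfolding R
    proof (rule generate.incl, rule UnI2)
      show "frag_of (f, sign \<pi> * s, ?ks) - frag_of (f, s, js) \<in> ?O"
        unfolding mem_Collect_eq by (intro exI[of _ f] exI[of _ s] exI[of _ js] exI[of _ \<pi>]) (simp add: sym \<pi>)
    qed
    have ksym: "(f, 1, ?ks) \<in> conormal_symbols X p"
      using js by (simp add: conormal_symbols_iff)
    have neg: "frag_of (f, - 1, ?ks) + frag_of (f, 1, ?ks) \<in> conormal_relations X p"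
      unfolding R
    proof (rule generate.incl, rule UnI1)
      show "frag_of (f, - 1, ?ks) + frag_of (f, 1, ?ks) \<in> ?N"
        unfolding mem_Collect_eq by (intro exI[of _ f] exI[of _ 1] exI[of _ ?ks]) (simp add: ksym)
    qed
    have sc: "standard_chain X (symbol_value (f, s, js)) = frag_cmul (sign \<pi> * s) (frag_of (f, 1, ?ks))"
      using js(1) ls by (simp add: symbol_value_def frag_extend_cmul standard_symbol_def mult.commute)
    have "sign \<pi> * s = 1 \<or> sign \<pi> * s = - 1" using js(2) by (cases \<pi> rule: sign_cases) auto
    then show ?thesis
    proof
      assume 1: "sign \<pi> * s = 1"
      show ?thesis using Rneg[OF rel] unfolding \<sigma>_eq sc 1 by simp
    next
      assume 1: "sign \<pi> * s = - 1"
      show ?thesis using Rdiff[OF neg rel] unfolding \<sigma>_eq sc 1 by (simp add: algebra_simps)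
    qed
  qed
  show "?Ker \<subseteq> conormal_relations X p"
  proof
    fix x assume "x \<in> ?Ker"
    then have x: "Poly_Mapping.keys x \<subseteq> conormal_symbols X p" "chain_value x = 0" by auto
    from x(1) have "x - standard_chain X (chain_value x) \<in> conormal_relations X p"
    proof (induction x rule: frag_induction)
      case zero then show ?case using R0 by simp
    next
      case (one \<sigma>) then show ?case unfolding frag_extend_of by (rule single)
    next
      case (diff a b)
      have eq: "a - b - (A - B) = a - A - (b - B)" for A B :: "'a conormal_symbol \<Rightarrow>\<^sub>0 int" by simp
      show ?case unfolding frag_extend_diff eq by (rule Rdiff[OF diff])
    qed
    then show "x \<in> conormal_relations X p" using x(2) by simp
  qed
qed

text \<open>
  The element of the conormal chain group that has the coordinates \<open>u\<close>. In these terms the quotient by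
  the relations disappears: the map \<open>u \<mapsto> chain_class X p u\<close> is an isomorphism from the free abelian
  group on the faces, and it carries the oriented boundary to the conormal boundary.
\<close>

definition chain_class :: "'a corner_data \<Rightarrow> int \<Rightarrow> (nat set \<Rightarrow>\<^sub>0 int) \<Rightarrow> ('a conormal_symbol \<Rightarrow>\<^sub>0 int) set" where
  "chain_class X p u = {x. Poly_Mapping.keys x \<subseteq> conormal_symbols X p \<and> chain_value x = u}"

lemma coset_eq_chain_class:
  assumes "Poly_Mapping.keys x \<subseteq> conormal_symbols X p"
  shows "conormal_relations X p #>\<^bsub>free_Abelian_group (conormal_symbols X p)\<^esub> x = chain_class X p (chain_value x)"
proof -
  have "y \<in> chain_class X p (chain_value x) \<longleftrightarrow> y - x \<in> conormal_relations X p" for y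
  proof
    assume "y \<in> chain_class X p (chain_value x)"
    then show "y - x \<in> conormal_relations X p"
      using assms keys_diff[of y x] by (auto simp: chain_class_def conormal_relations_eq frag_extend_diff)
  next
    assume "y - x \<in> conormal_relations X p"
    then have d: "Poly_Mapping.keys (y - x) \<subseteq> conormal_symbols X p" "chain_value (y - x) = 0"
      by (simp_all add: conormal_relations_eq)
    have "Poly_Mapping.keys (y - x + x) \<subseteq> conormal_symbols X p"
      using d(1) assms keys_add[of "y - x" x] by blast
    with d(2) show "y \<in> chain_class X p (chain_value x)" by (simp add: chain_class_def frag_extend_diff)
  qed
  moreover have "y \<in> conormal_relations X p #>\<^bsub>free_Abelian_group (conormal_symbols X p)\<^esub> x
      \<longleftrightarrow> y - x \<in> conormal_relations X p" for y
  proof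
    assume "y \<in> conormal_relations X p #>\<^bsub>free_Abelian_group (conormal_symbols X p)\<^esub> x"
    then show "y - x \<in> conormal_relations X p" by (auto simp: r_coset_def)
  next
    assume "y - x \<in> conormal_relations X p"
    then show "y \<in> conormal_relations X p #>\<^bsub>free_Abelian_group (conormal_symbols X p)\<^esub> x"
      unfolding r_coset_def by (intro UN_I[of "y - x"]) simp_all
  qed
  ultimately show ?thesis by blast
qed

lemma standard_chain_in_class:
  "Poly_Mapping.keys u \<subseteq> faces X p \<Longrightarrow> standard_chain X u \<in> chain_class X p u"
  by (simp add: chain_class_def keys_standard_chain chain_value_standard_chain)

lemma carrier_conormal_chain_group:
  "carrier (conormal_chain_group X p) = chain_class X p ` {u. Poly_Mapping.keys u \<subseteq> faces X p}"
proof -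
  have "carrier (conormal_chain_group X p)
      = (\<lambda>x. chain_class X p (chain_value x)) ` {x. Poly_Mapping.keys x \<subseteq> conormal_symbols X p}"
    unfolding conormal_chain_group_def carrier_FactGroup
    by (rule image_cong) (auto simp: coset_eq_chain_class)
  also have "\<dots> = chain_class X p ` {u. Poly_Mapping.keys u \<subseteq> faces X p}"
  proof (intro equalityI subsetI)
    fix S assume "S \<in> (\<lambda>x. chain_class X p (chain_value x)) ` {x. Poly_Mapping.keys x \<subseteq> conormal_symbols X p}"
    then show "S \<in> chain_class X p ` {u. Poly_Mapping.keys u \<subseteq> faces X p}"
      using keys_chain_value by blast
  next
    fix S assume "S \<in> chain_class X p ` {u. Poly_Mapping.keys u \<subseteq> faces X p}"
    then obtain u where u: "Poly_Mapping.keys u \<subseteq> faces X p" "S = chain_class X p u" by blast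
    then show "S \<in> (\<lambda>x. chain_class X p (chain_value x)) ` {x. Poly_Mapping.keys x \<subseteq> conormal_symbols X p}"
      by (intro image_eqI[of _ _ "standard_chain X u"]) (simp_all add: chain_value_standard_chain keys_standard_chain)
  qed
  finally show ?thesis .
qed

lemma mult_chain_class:
  assumes "Poly_Mapping.keys u \<subseteq> faces X p" "Poly_Mapping.keys v \<subseteq> faces X p"
  shows "chain_class X p u \<otimes>\<^bsub>conormal_chain_group X p\<^esub> chain_class X p v = chain_class X p (u + v)"
proof -
  have "chain_class X p u <#>\<^bsub>free_Abelian_group (conormal_symbols X p)\<^esub> chain_class X p v = chain_class X p (u + v)"
  proof (intro equalityI subsetI)
    fix z assume "z \<in> chain_class X p u <#>\<^bsub>free_Abelian_group (conormal_symbols X p)\<^esub> chain_class X p v"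
    then obtain x y where "x \<in> chain_class X p u" "y \<in> chain_class X p v" "z = x + y"
      by (auto simp: set_mult_def)
    then show "z \<in> chain_class X p (u + v)"
      using keys_add[of x y] by (auto simp: chain_class_def frag_extend_add)
  next
    fix z assume z: "z \<in> chain_class X p (u + v)"
    let ?x = "standard_chain X u"
    have x: "?x \<in> chain_class X p u" using assms(1) by (rule standard_chain_in_class)
    have "z - ?x \<in> chain_class X p v"
      using z x keys_diff[of z ?x] by (auto simp: chain_class_def frag_extend_diff)
    then show "z \<in> chain_class X p u <#>\<^bsub>free_Abelian_group (conormal_symbols X p)\<^esub> chain_class X p v"
      using x unfolding set_mult_def by (intro UN_I[of ?x] UN_I[of "z - ?x"]) simp_all
  qed
  then show ?thesis by (simp add: conormal_chain_group_def)
qed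

lemma one_conormal_chain_group: "\<one>\<^bsub>conormal_chain_group X p\<^esub> = chain_class X p 0"
  by (auto simp: conormal_chain_group_def conormal_relations_eq chain_class_def)

lemma chain_class_inject:
  assumes "Poly_Mapping.keys u \<subseteq> faces X p"
  shows "chain_class X p u = chain_class X p v \<longleftrightarrow> u = v"
proof
  assume "chain_class X p u = chain_class X p v"
  then have "standard_chain X u \<in> chain_class X p v" using standard_chain_in_class[OF assms] by simp
  then show "u = v" using chain_value_standard_chain[OF assms] by (simp add: chain_class_def)
qed simp

lemma conormal_boundary_chain_class:
  assumes X: "corner_space X \<noteq> {}" and u: "Poly_Mapping.keys u \<subseteq> faces X p"
  shows "conormal_boundary X p (chain_class X p u) = chain_class X (p - 1) (oriented_boundary u)"
proof -
  have "conormal_relations X (p - 1) #>\<^bsub>free_Abelian_group (conormal_symbols X (p - 1))\<^esub> frag_extend (symbol_boundary X) c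
      = chain_class X (p - 1) (oriented_boundary u)" if "c \<in> chain_class X p u" for c
  proof -
    have c: "Poly_Mapping.keys c \<subseteq> conormal_symbols X p" "chain_value c = u" using that by (auto simp: chain_class_def)
    show ?thesis
      unfolding coset_eq_chain_class[OF keys_boundary_chain[OF X c(1)]] chain_value_boundary[OF c(1)] c(2) ..
  qed
  then show ?thesis
    unfolding conormal_boundary_def using standard_chain_in_class[OF u] by blast
qed

lemma keys_oriented_boundary_faces:
  assumes X: "corner_space X \<noteq> {}" and u: "Poly_Mapping.keys u \<subseteq> faces X p"
  shows "Poly_Mapping.keys (oriented_boundary u) \<subseteq> faces X (p - 1)"
proof -
  have "Poly_Mapping.keys (oriented_boundary (chain_value (standard_chain X u))) \<subseteq> faces X (p - 1)"
    unfolding chain_value_boundary[OF keys_standard_chain[OF u], symmetric]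
    by (intro keys_chain_value keys_boundary_chain X keys_standard_chain u)
  then show ?thesis by (simp only: chain_value_standard_chain[OF u])
qed

lemma group_conormal_chain_group: "group (conormal_chain_group X p)"
proof -
  let ?G = "free_Abelian_group (conormal_symbols X p)"
  interpret comm_group ?G by (rule abelian_free_Abelian_group)
  have "subgroup (conormal_relations X p) ?G"
    unfolding conormal_relations_def
  proof (rule generate_is_subgroup)
    show "{frag_of (f, - s, js) + frag_of (f, s, js) | f s js. (f, s, js) \<in> conormal_symbols X p} \<union>
        {frag_of (f, sign \<pi> * s, permute_list \<pi> js) - frag_of (f, s, js) | f s js \<pi>.
           (f, s, js) \<in> conormal_symbols X p \<and> \<pi> permutes {..<length js}} \<subseteq> carrier ?G"
      (is "?gens \<subseteq> _")
    proof
      fix r assume "r \<in> ?gens"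
      then have "r \<in> conormal_relations X p" unfolding conormal_relations_def by (rule generate.incl)
      then show "r \<in> carrier ?G" by (simp add: conormal_relations_eq)
    qed
  qed
  then show ?thesis unfolding conormal_chain_group_def
    using abelian_FactGroup comm_group_def by blast
qed

lemma oriented_boundary_empty_face:
  assumes "Poly_Mapping.keys x \<subseteq> {{}}"
  shows "oriented_boundary x = 0"
  using assms
  by (induction x rule: frag_induction)
    (simp_all add: oriented_boundary_def face_boundary_def frag_extend_diff)

text \<open>
  For simplices with at least two vertices this is inherited from singular chains and their augmentation.
\<close>

lemma oriented_boundary_boundary:
  assumes K: "finite_complex K" and x: "Poly_Mapping.keys x \<subseteq> {J \<in> K. int (card J) = p}"
  shows "oriented_boundary (oriented_boundary x) = 0"
proof -
  consider "p < 0" | "p = int 0" | "p = int (Suc 0)" | n where "p = int (Suc (Suc n))"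
    by (metis linorder_not_le nat_0_le not0_implies_Suc)
  then show ?thesis
  proof cases
    case 1
    then have "Poly_Mapping.keys x \<subseteq> {}" using x by auto
    then show ?thesis by (simp add: oriented_boundary_def)
  next
    case 2
    have "Poly_Mapping.keys x \<subseteq> {{}}" using x 2 finite_complex_finite[OF K] by auto
    then have "oriented_boundary x = 0" by (rule oriented_boundary_empty_face)
    then show ?thesis by (simp add: oriented_boundary_def)
  next
    case 3
    have "Poly_Mapping.keys (oriented_boundary x) \<subseteq> {J \<in> K. card J = 0}"
      using x 3 by (intro keys_oriented_boundary[OF K]) auto
    then have "Poly_Mapping.keys (oriented_boundary x) \<subseteq> {{}}" using finite_complex_finite[OF K] by auto
    then show ?thesis by (rule oriented_boundary_empty_face)
  next
    case 4
    have x': "Poly_Mapping.keys x \<subseteq> {J \<in> K. card J = Suc (Suc n)}" using x 4 by auto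
    show ?thesis
    proof (rule oriented_boundary_eq_0[OF K keys_oriented_boundary[OF K x']])
      show "singular_chain (Suc n) (subtopology (powertop_real UNIV) (realization_set K)) (affine_chain x)"
        by (intro affine_chain_in_imp_singular_chain[OF K] affine_chain_in_affine_chain x')
      show "affine_chain (oriented_boundary x) = chain_boundary (Suc n) (affine_chain x)"
        using chain_boundary_affine_chain[OF subset_trans[OF x' finite_complex_faces[OF K]]] by simp
    qed
  qed
qed

text \<open>
  A group is isomorphic to conormal homology as soon as the oriented cycles of the index complex map
  onto it additively, with precisely the oriented boundaries mapping to the unit.
\<close>

lemma conormal_homology_iso:
  fixes H :: "('h, 'm) monoid_scheme"
  defines "Z \<equiv> \<lambda>X p. {x. Poly_Mapping.keys x \<subseteq> faces X p \<and> oriented_boundary x = 0}"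
  assumes X: "corner_space X \<noteq> {}" and H: "group H"
    and hH: "h ` Z X p = carrier H"
    and hadd: "\<And>x y. x \<in> Z X p \<Longrightarrow> y \<in> Z X p \<Longrightarrow> h (x + y) = h x \<otimes>\<^bsub>H\<^esub> h y"
    and hker: "\<And>x. x \<in> Z X p \<Longrightarrow>
       h x = \<one>\<^bsub>H\<^esub> \<longleftrightarrow> (\<exists>y. Poly_Mapping.keys y \<subseteq> faces X (p + 1) \<and> x = oriented_boundary y)"
  shows "conormal_homology X p \<cong> H"
proof -
  let ?Q = "conormal_chain_group X p" and ?Q' = "conormal_chain_group X (p - 1)"
  let ?D = "conormal_boundary X p"
  have cls: "chain_class X q u \<in> carrier (conormal_chain_group X q)"
    if "Poly_Mapping.keys u \<subseteq> faces X q" for u q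
    using that unfolding carrier_conormal_chain_group by blast
  have D: "?D \<in> hom ?Q ?Q'"
  proof (rule homI)
    fix S assume "S \<in> carrier ?Q"
    then obtain u where u: "Poly_Mapping.keys u \<subseteq> faces X p" "S = chain_class X p u"
      unfolding carrier_conormal_chain_group by blast
    show "?D S \<in> carrier ?Q'"
      unfolding u(2) conormal_boundary_chain_class[OF X u(1)] by (rule cls[OF keys_oriented_boundary_faces[OF X u(1)]])
    fix T assume "T \<in> carrier ?Q"
    then obtain v where v: "Poly_Mapping.keys v \<subseteq> faces X p" "T = chain_class X p v"
      unfolding carrier_conormal_chain_group by blast
    have uv: "Poly_Mapping.keys (u + v) \<subseteq> faces X p"
      using u(1) v(1) keys_add[of u v] by blast
    show "?D (S \<otimes>\<^bsub>?Q\<^esub> T) = ?D S \<otimes>\<^bsub>?Q'\<^esub> ?D T"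
      unfolding u(2) v(2) mult_chain_class[OF u(1) v(1)] conormal_boundary_chain_class[OF X uv]
        conormal_boundary_chain_class[OF X u(1)] conormal_boundary_chain_class[OF X v(1)]
        mult_chain_class[OF keys_oriented_boundary_faces[OF X u(1)] keys_oriented_boundary_faces[OF X v(1)]]
        oriented_boundary_add ..
  qed
  interpret D: group_hom ?Q ?Q' ?D
    by (simp add: group_hom_def group_hom_axioms_def group_conormal_chain_group D)
  let ?K = "kernel ?Q ?Q' ?D"
  have K: "?K = chain_class X p ` Z X p"
  proof -
    have "?D (chain_class X p u) = \<one>\<^bsub>?Q'\<^esub> \<longleftrightarrow> oriented_boundary u = 0"
      if "Poly_Mapping.keys u \<subseteq> faces X p" for u
      unfolding one_conormal_chain_group conormal_boundary_chain_class[OF X that] by (rule chain_class_inject[OF keys_oriented_boundary_faces[OF X that]])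
    then show ?thesis
      unfolding kernel_def carrier_conormal_chain_group Z_def by blast
  qed
  have subK: "subgroup ?K ?Q" by (rule D.subgroup_kernel)
  let ?P = "subgroup_generated ?Q ?K"
  have carP: "carrier ?P = chain_class X p ` Z X p"
    using subgroup.carrier_subgroup_generated_subgroup[OF subK] K by simp
  \<comment> \<open>All representatives of a class have the same coordinates, so any choice defines the same map.\<close>
  define g where "g S = h (chain_value (SOME x. x \<in> S))" for S :: "('a conormal_symbol \<Rightarrow>\<^sub>0 int) set"
  have g: "g (chain_class X p u) = h u" if "u \<in> Z X p" for u
  proof -
    have "(SOME x. x \<in> chain_class X p u) \<in> chain_class X p u"
    proof (rule someI)
      show "standard_chain X u \<in> chain_class X p u"
        by (rule standard_chain_in_class) (use that in \<open>unfold Z_def, blast\<close>)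
    qed
    then have "chain_value (SOME x. x \<in> chain_class X p u) = u" by (simp only: chain_class_def mem_Collect_eq)
    then show ?thesis by (simp add: g_def)
  qed
  have Zadd: "u + v \<in> Z X p" if "u \<in> Z X p" "v \<in> Z X p" for u v
    using that keys_add[of u v] unfolding Z_def mem_Collect_eq oriented_boundary_add by (simp, blast)
  have ghom: "g \<in> hom ?P H"
  proof (rule homI)
    fix S assume "S \<in> carrier ?P"
    then obtain u where u: "u \<in> Z X p" "S = chain_class X p u" unfolding carP by blast
    show "g S \<in> carrier H" unfolding u(2) g[OF u(1)] using hH u(1) by blast
    fix T assume "T \<in> carrier ?P"
    then obtain v where v: "v \<in> Z X p" "T = chain_class X p v" unfolding carP by blast
    have k: "Poly_Mapping.keys u \<subseteq> faces X p" "Poly_Mapping.keys v \<subseteq> faces X p" using u(1) v(1) unfolding Z_def by blast+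
    have "S \<otimes>\<^bsub>?P\<^esub> T = chain_class X p (u + v)"
      unfolding u(2) v(2) mult_subgroup_generated by (rule mult_chain_class[OF k])
    then show "g (S \<otimes>\<^bsub>?P\<^esub> T) = g S \<otimes>\<^bsub>H\<^esub> g T"
      using g[OF Zadd[OF u(1) v(1)]] hadd[OF u(1) v(1)] g[OF u(1)] g[OF v(1)] u(2) v(2) by simp
  qed
  interpret g: group_hom ?P H g
    by (simp add: group_hom_def group_hom_axioms_def H ghom D.G.group_subgroup_generated)
  have "g ` carrier ?P = carrier H"
    unfolding carP image_image hH[symmetric] by (rule image_cong[OF refl g])
  then have "?P Mod kernel ?P H g \<cong> H" by (rule g.FactGroup_iso)
  moreover have "kernel ?P H g = conormal_boundary X (p + 1) ` carrier (conormal_chain_group X (p + 1))"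
  proof -
    have ker: "S \<in> kernel ?P H g \<longleftrightarrow> S \<in> chain_class X p ` Z X p \<and> g S = \<one>\<^bsub>H\<^esub>" for S
      using carP by (simp add: kernel_def[of ?P])
    have b: "conormal_boundary X (p + 1) (chain_class X (p + 1) y) = chain_class X p (oriented_boundary y)"
      if "Poly_Mapping.keys y \<subseteq> faces X (p + 1)" for y
      using conormal_boundary_chain_class[OF X that] by simp
    have bZ: "oriented_boundary y \<in> Z X p" if y: "Poly_Mapping.keys y \<subseteq> faces X (p + 1)" for y
      using keys_oriented_boundary_faces[OF X y] oriented_boundary_boundary[OF finite_complex_index_complex[OF X] y]
      by (simp add: Z_def)
    show ?thesis
    proof (intro equalityI subsetI)
      fix S assume "S \<in> kernel ?P H g"
      then obtain u where u: "u \<in> Z X p" "S = chain_class X p u" "g S = \<one>\<^bsub>H\<^esub>"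
        unfolding ker by blast
      then have "h u = \<one>\<^bsub>H\<^esub>" using g by simp
      then obtain y where y: "Poly_Mapping.keys y \<subseteq> faces X (p + 1)" "u = oriented_boundary y"
        using hker[OF u(1)] by blast
      show "S \<in> conormal_boundary X (p + 1) ` carrier (conormal_chain_group X (p + 1))"
        by (rule image_eqI[of _ _ "chain_class X (p + 1) y"]) (simp_all only: u(2) y(2) b[OF y(1)] cls[OF y(1)])
    next
      fix S assume "S \<in> conormal_boundary X (p + 1) ` carrier (conormal_chain_group X (p + 1))"
      then obtain y where y: "Poly_Mapping.keys y \<subseteq> faces X (p + 1)" "S = chain_class X p (oriented_boundary y)"
        unfolding carrier_conormal_chain_group using b by blast
      have "h (oriented_boundary y) = \<one>\<^bsub>H\<^esub>" using hker[OF bZ[OF y(1)]] y(1) by blast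
      then show "S \<in> kernel ?P H g"
        unfolding ker y(2) g[OF bZ[OF y(1)]] using bZ[OF y(1)] by blast
    qed
  qed
  ultimately show ?thesis by (simp add: conormal_homology_def)
qed

section \<open>Realizations of the index complex and of the corner structure complex\<close>

text \<open>
  The simplicial map induced by \<open>\<phi>\<close>, in barycentric coordinates; \<open>V\<close> is the set of all vertices.
\<close>

definition push_coordinates :: "('v \<Rightarrow> 'w) \<Rightarrow> 'v set \<Rightarrow> ('v \<Rightarrow> real) \<Rightarrow> ('w \<Rightarrow> real)" where
  "push_coordinates \<phi> V t = (\<lambda>w. \<Sum>v\<in>{v \<in> V. \<phi> v = w}. t v)"

lemma push_coordinates_support: "{w. push_coordinates \<phi> V t w \<noteq> 0} \<subseteq> \<phi> ` {v. t v \<noteq> 0}"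
proof
  fix w assume "w \<in> {w. push_coordinates \<phi> V t w \<noteq> 0}"
  then obtain v where "v \<in> {v \<in> V. \<phi> v = w}" "t v \<noteq> 0"
    unfolding push_coordinates_def using sum.neutral by (metis (mono_tags, lifting) mem_Collect_eq)
  then show "w \<in> \<phi> ` {v. t v \<noteq> 0}" by auto
qed

lemma push_coordinates_realization_set:
  assumes K: "finite_complex K" and L: "finite_complex L" and \<phi>: "\<And>J. J \<in> K \<Longrightarrow> \<phi> ` J \<in> L"
    and t: "t \<in> realization_set K"
  shows "push_coordinates \<phi> (\<Union>K) t \<in> realization_set L"
proof (rule realization_setI[of "\<phi> ` \<Union>K"])
  have fin: "finite (\<Union>K)" using K by (simp add: finite_complex_def)
  then show "finite (\<phi> ` \<Union>K)" by simp
  have supp: "{v. t v \<noteq> 0} \<in> K" by (rule realization_set_support(1)[OF t])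
  show "0 \<le> push_coordinates \<phi> (\<Union>K) t w" for w
    unfolding push_coordinates_def by (rule sum_nonneg) (rule realization_set_support(2)[OF t])
  show "push_coordinates \<phi> (\<Union>K) t w = 0" if "w \<notin> \<phi> ` \<Union>K" for w
    unfolding push_coordinates_def by (rule sum.neutral) (use that in blast)
  show "{w. push_coordinates \<phi> (\<Union>K) t w \<noteq> 0} \<in> L"
    by (rule finite_complex_subset[OF L \<phi>[OF supp] push_coordinates_support])
  have "(\<Sum>w\<in>\<phi> ` \<Union>K. push_coordinates \<phi> (\<Union>K) t w) = (\<Sum>v\<in>\<Union>K. t v)"
    unfolding push_coordinates_def by (rule sum.image_gen[OF fin, symmetric])
  also have "\<dots> = 1" by (rule realization_set_sum[OF t fin]) (use supp in blast)
  finally show "(\<Sum>w\<in>\<phi> ` \<Union>K. push_coordinates \<phi> (\<Union>K) t w) = 1" .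
qed

lemma continuous_map_push_coordinates:
  assumes K: "finite_complex K" and L: "finite_complex L" and \<phi>: "\<And>J. J \<in> K \<Longrightarrow> \<phi> ` J \<in> L"
  shows "continuous_map (geometric_realization K) (geometric_realization L) (push_coordinates \<phi> (\<Union>K))"
  unfolding geometric_realization_eq continuous_map_in_subtopology continuous_map_componentwise_UNIV
proof (intro conjI allI)
  fix w
  have fin: "finite {v \<in> \<Union>K. \<phi> v = w}"
    by (rule finite_subset[of _ "\<Union>K"]) (use K in \<open>auto simp: finite_complex_def\<close>)
  show "continuous_map (subtopology (powertop_real UNIV) (realization_set K)) euclideanreal
      (\<lambda>t. push_coordinates \<phi> (\<Union>K) t w)"
    unfolding push_coordinates_def
    by (intro continuous_map_sum continuous_map_from_subtopology continuous_map_product_projection fin UNIV_I)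
next
  show "push_coordinates \<phi> (\<Union>K) \<in> topspace (subtopology (powertop_real UNIV) (realization_set K)) \<rightarrow> realization_set L"
    using push_coordinates_realization_set[OF K L \<phi>] by auto
qed

lemma homotopic_contiguous_id:
  assumes K: "finite_complex K" and c: "continuous_map (geometric_realization K) (geometric_realization K) f"
    and supp: "\<And>t. t \<in> realization_set K \<Longrightarrow> \<exists>J\<in>K. {v. t v \<noteq> 0} \<subseteq> J \<and> {v. f t v \<noteq> 0} \<subseteq> J"
  shows "homotopic_with (\<lambda>h. True) (geometric_realization K) (geometric_realization K) f id"
proof -
  let ?R = "subtopology (powertop_real UNIV) (realization_set K)"
  have im: "f t \<in> realization_set K" if "t \<in> realization_set K" for t
    using c that unfolding geometric_realization_eq continuous_map_in_subtopology by auto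
  have cf: "continuous_map ?R (powertop_real UNIV) f"
    using c unfolding geometric_realization_eq continuous_map_in_subtopology by auto
  show ?thesis
    unfolding geometric_realization_eq
  proof (rule straight_line_homotopic[OF cf])
    show "continuous_map ?R (powertop_real UNIV) id" by simp
    fix t :: "'a \<Rightarrow> real" and s :: real
    assume "t \<in> topspace ?R" and s: "0 \<le> s" "s \<le> 1"
    then have t: "t \<in> realization_set K" by simp
    obtain J where "J \<in> K" "{v. t v \<noteq> 0} \<subseteq> J" "{v. f t v \<noteq> 0} \<subseteq> J" using supp[OF t] by blast
    then show "(\<lambda>v. (1 - s) * f t v + s * id t v) \<in> realization_set K"
      using realization_set_convex[OF K _ im[OF t] _ t _ s] by simp
  qed
qed

text \<open>
  Simplicial maps in both directions whose composites are contiguous to the identity: a point and its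
  image always lie in a common simplex, so the segment between them stays in the realization.
\<close>

lemma homotopy_equivalent_realizations:
  assumes K: "finite_complex K" and L: "finite_complex L"
    and \<phi>: "\<And>J. J \<in> K \<Longrightarrow> \<phi> ` J \<in> L" and \<psi>: "\<And>I. I \<in> L \<Longrightarrow> \<psi> ` I \<in> K"
    and \<psi>\<phi>: "\<And>J. J \<in> K \<Longrightarrow> J \<union> \<psi> ` \<phi> ` J \<in> K"
    and \<phi>\<psi>: "\<And>I. I \<in> L \<Longrightarrow> I \<union> \<phi> ` \<psi> ` I \<in> L"
  shows "geometric_realization K homotopy_equivalent_space geometric_realization L"
proof -
  let ?f = "push_coordinates \<phi> (\<Union>K)" and ?g = "push_coordinates \<psi> (\<Union>L)"
  have f: "continuous_map (geometric_realization K) (geometric_realization L) ?f"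
    by (rule continuous_map_push_coordinates[OF K L \<phi>])
  have g: "continuous_map (geometric_realization L) (geometric_realization K) ?g"
    by (rule continuous_map_push_coordinates[OF L K \<psi>])
  have "homotopic_with (\<lambda>h. True) (geometric_realization K) (geometric_realization K) (?g \<circ> ?f) id"
  proof (rule homotopic_contiguous_id[OF K continuous_map_compose[OF f g]])
    fix t assume t: "t \<in> realization_set K"
    let ?J = "{v. t v \<noteq> 0}"
    have "{v. (?g \<circ> ?f) t v \<noteq> 0} \<subseteq> \<psi> ` \<phi> ` ?J"
      using push_coordinates_support[of \<psi> "\<Union>L" "?f t"] push_coordinates_support[of \<phi> "\<Union>K" t] by fastforce
    then show "\<exists>J\<in>K. ?J \<subseteq> J \<and> {v. (?g \<circ> ?f) t v \<noteq> 0} \<subseteq> J"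
      by (intro bexI[OF _ \<psi>\<phi>[OF realization_set_support(1)[OF t]]]) blast
  qed
  moreover have "homotopic_with (\<lambda>h. True) (geometric_realization L) (geometric_realization L) (?f \<circ> ?g) id"
  proof (rule homotopic_contiguous_id[OF L continuous_map_compose[OF g f]])
    fix t assume t: "t \<in> realization_set L"
    let ?J = "{v. t v \<noteq> 0}"
    have "{v. (?f \<circ> ?g) t v \<noteq> 0} \<subseteq> \<phi> ` \<psi> ` ?J"
      using push_coordinates_support[of \<phi> "\<Union>K" "?g t"] push_coordinates_support[of \<psi> "\<Union>L" t] by fastforce
    then show "\<exists>J\<in>L. ?J \<subseteq> J \<and> {v. (?f \<circ> ?g) t v \<noteq> 0} \<subseteq> J"
      by (intro bexI[OF _ \<phi>\<psi>[OF realization_set_support(1)[OF t]]]) blast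
  qed
  ultimately show ?thesis using f g unfolding homotopy_equivalent_space_def by blast
qed

lemma realization_set_eq_empty_iff:
  assumes K: "finite_complex K"
  shows "realization_set K = {} \<longleftrightarrow> \<Union>K = {}"
proof
  assume e: "realization_set K = {}"
  have "vertex_point v \<in> realization_set K" if "v \<in> J" "J \<in> K" for v J
  proof (rule realization_setI[of "{v}"])
    have "{v} \<in> K" using finite_complex_subset[OF K that(2)] that(1) by blast
    then show "{u. vertex_point v u \<noteq> 0} \<in> K" by (simp add: vertex_point_def)
  qed (auto simp: vertex_point_def)
  then show "\<Union>K = {}" using e by blast
next
  assume e: "\<Union>K = {}"
  show "realization_set K = {}"
  proof (rule ccontr)
    assume "realization_set K \<noteq> {}"
    then obtain t where t: "t \<in> realization_set K" by blast
    have "{v. t v \<noteq> 0} \<subseteq> {}" using realization_set_support(1)[OF t] e by blast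
    from realization_set_sum[OF t _ this] show False by simp
  qed
qed

lemma finite_complex_corner_structure_complex: "finite_complex (corner_structure_complex X)"
  unfolding finite_complex_def
proof (intro conjI ballI allI impI)
  show "{} \<in> corner_structure_complex X" by (simp add: corner_structure_complex_def)
  show "finite (\<Union>(corner_structure_complex X))"
    by (rule finite_subset[of _ "hyperface X ` {1..num_bdf X}"]) (auto simp: corner_structure_complex_def)
  show "I \<in> corner_structure_complex X" if "J \<in> corner_structure_complex X" "I \<subseteq> J" for I J
    using that unfolding corner_structure_complex_def by blast
qed

lemma corner_face_nonempty: "J \<noteq> {} \<Longrightarrow> corner_face X J = \<Inter>(hyperface X ` J)"
  by (simp add: corner_face_def)

lemma index_complex_image:
  assumes "J \<in> index_complex X" shows "hyperface X ` J \<in> corner_structure_complex X"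
proof (cases "J = {}")
  case False
  have J: "J \<subseteq> {1..num_bdf X}" "\<Inter>(hyperface X ` J) \<noteq> {}"
    using assms unfolding index_complex_def mem_Collect_eq corner_face_nonempty[OF False] by simp_all
  show ?thesis
    unfolding corner_structure_complex_def mem_Collect_eq by (intro conjI image_mono J)
qed (simp add: corner_structure_complex_def)

text \<open>
  Different indices might name the same set; one index is chosen for each hyperface.
\<close>

abbreviation hyperface_index :: "'a corner_data \<Rightarrow> 'a set \<Rightarrow> nat" where
  "hyperface_index X \<equiv> inv_into {1..num_bdf X} (hyperface X)"

lemma hyperface_hyperface_index:
  assumes "I \<in> corner_structure_complex X" shows "hyperface X ` hyperface_index X ` I = I"
  by (rule image_inv_into_cancel[OF refl]) (use assms in \<open>simp add: corner_structure_complex_def\<close>)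

lemma corner_structure_complex_index:
  assumes X: "corner_space X \<noteq> {}" and I: "I \<in> corner_structure_complex X"
  shows "hyperface_index X ` I \<in> index_complex X"
proof -
  have 1: "hyperface_index X ` I \<subseteq> {1..num_bdf X}"
    using I inv_into_into[of _ "hyperface X" "{1..num_bdf X}"] unfolding corner_structure_complex_def by blast
  have "corner_face X (hyperface_index X ` I) \<noteq> {}"
  proof (cases "I = {}")
    case True then show ?thesis using X by (simp add: corner_face_def)
  next
    case False
    then have ne: "hyperface_index X ` I \<noteq> {}" by simp
    show ?thesis using I unfolding corner_face_nonempty[OF ne] hyperface_hyperface_index[OF I]
      by (simp add: corner_structure_complex_def)
  qed
  with 1 show ?thesis by (simp add: index_complex_def)
qed

text \<open>
  A set of indices and the chosen indices of the same hyperfaces have the same intersection, so that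
  together they still form a simplex.
\<close>

lemma homotopy_equivalent_index_realization:
  assumes X: "corner_space X \<noteq> {}"
  shows "geometric_realization (index_complex X) homotopy_equivalent_space
         geometric_realization (corner_structure_complex X)"
proof (rule homotopy_equivalent_realizations[where \<phi> = "hyperface X" and \<psi> = "hyperface_index X"])
  show "J \<union> hyperface_index X ` hyperface X ` J \<in> index_complex X" if J: "J \<in> index_complex X" for J
  proof (cases "J = {}")
    case True then show ?thesis using J by simp
  next
    case False
    let ?I = "hyperface X ` J"
    have I: "?I \<in> corner_structure_complex X" by (rule index_complex_image[OF J])
    have idx: "hyperface_index X ` ?I \<in> index_complex X" by (rule corner_structure_complex_index[OF X I])
    have ne: "J \<union> hyperface_index X ` ?I \<noteq> {}" using False by simp
    have "hyperface X ` (J \<union> hyperface_index X ` ?I) = ?I"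
      unfolding image_Un hyperface_hyperface_index[OF I] by simp
    then have "corner_face X (J \<union> hyperface_index X ` ?I) = corner_face X J"
      unfolding corner_face_nonempty[OF ne] corner_face_nonempty[OF False] by simp
    then show ?thesis using J idx by (simp add: index_complex_def)
  qed
  show "I \<union> hyperface X ` hyperface_index X ` I \<in> corner_structure_complex X"
    if "I \<in> corner_structure_complex X" for I
    unfolding hyperface_hyperface_index[OF that] using that by simp
qed (assumption | rule finite_complex_index_complex[OF X] finite_complex_corner_structure_complex index_complex_image
    corner_structure_complex_index[OF X])+

section \<open>Reduced homology and the comparison theorem\<close>

text \<open>
  The homology of a point vanishes in positive degrees, and in degree 0 the class of the image
  of \<open>z\<close> is the sum of the coefficients of \<open>z\<close>.
\<close>

lemma reduced_class_iff:
  assumes z: "singular_relcycle q Y {} z"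
  shows "homologous_rel_set q Y {} z \<in> carrier (reduced_homology_group (int q) Y)
     \<longleftrightarrow> (q = 0 \<longrightarrow> augmentation z = (0 :: 'v set \<Rightarrow>\<^sub>0 int))"
proof -
  let ?pt = "discrete_topology {()}" and ?\<gamma> = "chain_map q (\<lambda>_. ()) z"
  have top: "topspace ?pt = {()}" by simp
  have cont: "continuous_map Y ?pt (\<lambda>_. ())" by simp
  have cyc: "singular_relcycle q ?pt {} ?\<gamma>"
    by (rule singular_relcycle_chain_map[OF z cont]) simp
  have "homologous_rel_set q Y {} z \<in> carrier (homology_group (int q) Y)"
    using z unfolding carrier_relative_homology_group by blast
  then have "homologous_rel_set q Y {} z \<in> carrier (reduced_homology_group (int q) Y)
     \<longleftrightarrow> hom_induced (int q) Y {} ?pt {} (\<lambda>_. ()) (homologous_rel_set q Y {} z) = \<one>\<^bsub>homology_group (int q) ?pt\<^esub>"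
    unfolding carrier_reduced_homology_group kernel_def by blast
  also have "hom_induced (int q) Y {} ?pt {} (\<lambda>_. ()) (homologous_rel_set q Y {} z) = homologous_rel_set q ?pt {} ?\<gamma>"
    by (rule hom_induced_chain_map[OF cont _ z]) simp
  also have "homologous_rel_set q ?pt {} ?\<gamma> = \<one>\<^bsub>homology_group (int q) ?pt\<^esub> \<longleftrightarrow> singular_relboundary q ?pt {} ?\<gamma>"
    unfolding one_relative_homology_group by (rule homologous_rel_set_eq_relboundary)
  also have "\<dots> \<longleftrightarrow> (q = 0 \<longrightarrow> ?\<gamma> = 0)"
    using cyc unfolding singular_boundary_singleton[OF top] singular_cycle_singleton[OF top] by auto
  also have "\<dots> \<longleftrightarrow> (q = 0 \<longrightarrow> augmentation z = 0)"
  proof -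
    let ?u = "restrict (\<lambda>_. ()) (standard_simplex q)"
    have \<gamma>: "?\<gamma> = frag_extend (\<lambda>_. frag_of ?u) z"
      unfolding chain_map_def by (rule frag_extend_eq) (simp add: simplex_map_def o_def)
    have univ: "Poly_Mapping.keys z \<subseteq> UNIV" by simp
    have 1: "augmentation (frag_extend (\<lambda>_. frag_of ?u) z) = augmentation z"
      using univ by (induction z rule: frag_induction) (simp_all add: frag_extend_diff)
    have 2: "frag_extend (\<lambda>_. frag_of ?u) (augmentation z) = frag_extend (\<lambda>_. frag_of ?u) z"
      using univ by (induction z rule: frag_induction) (simp_all add: frag_extend_diff)
    have "?\<gamma> = 0 \<longleftrightarrow> augmentation z = 0"
      unfolding \<gamma> using 1 2 by (metis frag_extend_0)
    then show ?thesis by blast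
  qed
  finally show ?thesis .
qed

lemma homologous_rel_set_hom:
  "homologous_rel_set q Y {} \<in> hom (relcycle_group q Y {}) (homology_group (int q) Y)"
  using normal.r_coset_hom_Mod[OF normal_subgroup_singular_relboundary_relcycle[of q Y "{}"]]
  by (simp add: nontrivial_relative_homology_group right_coset_singular_relboundary)

context
  fixes K :: "'v::linorder set set" and q :: nat
  assumes K: "finite_complex K"
begin

text \<open>
  A \<open>q\<close>-simplex has \<open>q + 1\<close> vertices: this is the shift of degrees by one. For \<open>q = 0\<close> being an oriented
  cycle includes the vanishing of the augmentation.
\<close>

abbreviation (input) "oriented_cycles \<equiv>
  {x. Poly_Mapping.keys x \<subseteq> {J \<in> K. card J = Suc q} \<and> oriented_boundary x = 0}"

abbreviation (input) "affine_class x \<equiv> homologous_rel_set q (geometric_realization K) {} (affine_chain x)"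

lemma affine_chain_cycle:
  assumes "x \<in> oriented_cycles"
  shows "singular_relcycle q (geometric_realization K) {} (affine_chain x)"
    "q = 0 \<Longrightarrow> augmentation (affine_chain x) = (0 :: 'v set \<Rightarrow>\<^sub>0 int)"
proof -
  have x: "Poly_Mapping.keys x \<subseteq> {J \<in> K. card J = Suc q}" "oriented_boundary x = 0" using assms by auto
  have "chain_boundary q (affine_chain x) = 0"
  proof (cases q)
    case 0 then show ?thesis by (simp add: chain_boundary_def)
  next
    case (Suc k)
    have k: "Poly_Mapping.keys x \<subseteq> {J. finite J \<and> card J = Suc (Suc k)}"
      using x(1) finite_complex_faces[OF K] Suc by blast
    show ?thesis unfolding Suc chain_boundary_affine_chain[OF k] x(2) by (simp add: affine_chain_def)
  qed
  then show "singular_relcycle q (geometric_realization K) {} (affine_chain x)"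
    unfolding singular_cycle geometric_realization_eq
    using affine_chain_in_imp_singular_chain[OF K affine_chain_in_affine_chain[OF x(1)]] by simp
  show "augmentation (affine_chain x) = (0 :: 'v set \<Rightarrow>\<^sub>0 int)" if "q = 0"
  proof -
    have "Poly_Mapping.keys x \<subseteq> {J. card J = Suc 0}" using x(1) that by auto
    then show ?thesis using augmentation_affine_chain[of x] x(2) by simp
  qed
qed

text \<open>
  The acyclicity of the quotient moves a singular cycle into the affine chains; the affine chain
  obtained is an oriented cycle because affine chains embed into singular chains, in degree 0
  because the augmentation does not see boundaries.
\<close>

lemma affine_class_image:
  "(\<lambda>x. affine_class x) ` oriented_cycles = carrier (reduced_homology_group (int q) (geometric_realization K))"
proof (intro equalityI subsetI)
  fix c assume "c \<in> (\<lambda>x. affine_class x) ` oriented_cycles"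
  then obtain x where x: "x \<in> oriented_cycles" "c = affine_class x" by blast
  show "c \<in> carrier (reduced_homology_group (int q) (geometric_realization K))"
    unfolding x(2) using affine_chain_cycle(2)[OF x(1)]
    by (intro iffD2[OF reduced_class_iff[OF affine_chain_cycle(1)[OF x(1)]]] impI)
next
  let ?Y = "subtopology (powertop_real UNIV) (realization_set K)"
  fix c assume c: "c \<in> carrier (reduced_homology_group (int q) (geometric_realization K))"
  then have "c \<in> carrier (homology_group (int q) (geometric_realization K))"
    using carrier_reduced_homology_group_subset by blast
  then obtain z where z: "singular_relcycle q (geometric_realization K) {} z"
      "c = homologous_rel_set q (geometric_realization K) {} z"
    unfolding carrier_relative_homology_group by blast
  have aug: "q = 0 \<Longrightarrow> augmentation z = (0 :: 'v set \<Rightarrow>\<^sub>0 int)" using c reduced_class_iff[OF z(1)] z(2) by blast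
  have zY: "singular_chain q ?Y z" "chain_boundary q z = 0"
    using z(1) by (auto simp: singular_cycle geometric_realization_eq)
  obtain y w where y: "affine_chain_in q K y" "singular_chain (Suc q) ?Y w" "z = y + chain_boundary (Suc q) w"
    by (rule homology_carried_byD[OF homology_carried_by_simplices[OF K] zY(1)]) (simp add: zY(2))
  obtain x where x: "Poly_Mapping.keys x \<subseteq> {J \<in> K. card J = Suc q}" "y = affine_chain x"
    using y(1) by (rule affine_chain_inE)
  have "oriented_boundary x = 0"
  proof (cases q)
    case 0
    have "augmentation z = (augmentation y :: 'v set \<Rightarrow>\<^sub>0 int)"
      unfolding y(3) frag_extend_add using augmentation_chain_boundary 0 by simp
    moreover have "augmentation y = oriented_boundary x"
      unfolding x(2) by (rule augmentation_affine_chain) (use x(1) 0 in auto)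
    ultimately show ?thesis using aug 0 by simp
  next
    case (Suc k)
    have k: "Poly_Mapping.keys x \<subseteq> {J. finite J \<and> card J = Suc (Suc k)}"
      using x(1) finite_complex_faces[OF K] Suc by blast
    have k': "Poly_Mapping.keys (oriented_boundary x) \<subseteq> {J. finite J \<and> card J = Suc k}"
      using keys_oriented_boundary[OF K x(1)] finite_complex_faces[OF K] Suc by blast
    have "affine_chain (oriented_boundary x) = chain_boundary q y"
      unfolding x(2) Suc chain_boundary_affine_chain[OF k] ..
    also have "\<dots> = chain_boundary q z"
      unfolding y(3) chain_boundary_add chain_boundary_boundary_alt[OF y(2)] by simp
    finally show ?thesis using zY(2) by (intro affine_chain_eq_0[OF k']) simp
  qed
  then have xc: "x \<in> oriented_cycles" using x(1) by simp
  have "c = affine_class x"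
  proof -
    have "homologous_rel q ?Y {} z y"
      unfolding homologous_rel_def singular_boundary using y(2,3) by (intro exI[of _ w]) simp
    then show ?thesis unfolding z(2) x(2)[symmetric] geometric_realization_eq homologous_rel_set_eq .
  qed
  then show "c \<in> (\<lambda>x. affine_class x) ` oriented_cycles" using xc by (rule image_eqI)
qed

lemma affine_class_add:
  assumes "x \<in> oriented_cycles" "y \<in> oriented_cycles"
  shows "affine_class (x + y) = affine_class x \<otimes>\<^bsub>reduced_homology_group (int q) (geometric_realization K)\<^esub> affine_class y"
  using hom_mult[OF homologous_rel_set_hom, of "affine_chain x" q "geometric_realization K" "affine_chain y"]
    affine_chain_cycle(1)[OF assms(1)] affine_chain_cycle(1)[OF assms(2)]
  by (simp add: reduced_homology_group_def affine_chain_def frag_extend_add)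

text \<open>
  If \<open>x\<close> bounds a singular chain, that chain has an affine boundary, so the acyclicity of the quotient
  replaces it by an affine chain with the same boundary.
\<close>

lemma affine_class_eq_one:
  assumes x: "x \<in> oriented_cycles"
  shows "affine_class x = \<one>\<^bsub>reduced_homology_group (int q) (geometric_realization K)\<^esub> \<longleftrightarrow>
    (\<exists>y. Poly_Mapping.keys y \<subseteq> {J \<in> K. card J = Suc (Suc q)} \<and> x = oriented_boundary y)"
proof -
  let ?Y = "subtopology (powertop_real UNIV) (realization_set K)"
  have kx: "Poly_Mapping.keys x \<subseteq> {J \<in> K. card J = Suc q}" using x by simp
  have bd: "chain_boundary (Suc q) (affine_chain y) = affine_chain (oriented_boundary y)"
    if "Poly_Mapping.keys y \<subseteq> {J \<in> K. card J = Suc (Suc q)}" for y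
    by (rule chain_boundary_affine_chain[OF subset_trans[OF that finite_complex_faces[OF K]]])
  have "affine_class x = \<one>\<^bsub>reduced_homology_group (int q) (geometric_realization K)\<^esub>
     \<longleftrightarrow> singular_relboundary q (geometric_realization K) {} (affine_chain x)"
    unfolding one_reduced_homology_group one_relative_homology_group by (rule homologous_rel_set_eq_relboundary)
  also have "\<dots> \<longleftrightarrow> (\<exists>w. singular_chain (Suc q) ?Y w \<and> chain_boundary (Suc q) w = affine_chain x)"
    unfolding singular_boundary geometric_realization_eq ..
  also have "\<dots> \<longleftrightarrow> (\<exists>y. Poly_Mapping.keys y \<subseteq> {J \<in> K. card J = Suc (Suc q)} \<and> x = oriented_boundary y)"
  proof
    assume "\<exists>w. singular_chain (Suc q) ?Y w \<and> chain_boundary (Suc q) w = affine_chain x"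
    then obtain w where w: "singular_chain (Suc q) ?Y w" "chain_boundary (Suc q) w = affine_chain x" by blast
    obtain v w' where v: "affine_chain_in (Suc q) K v" "singular_chain (Suc (Suc q)) ?Y w'"
        "w = v + chain_boundary (Suc (Suc q)) w'"
      by (rule homology_carried_byD[OF homology_carried_by_simplices[OF K] w(1)])
        (simp add: w(2) affine_chain_in_affine_chain[OF kx])
    obtain y where y: "Poly_Mapping.keys y \<subseteq> {J \<in> K. card J = Suc (Suc q)}" "v = affine_chain y"
      using v(1) by (rule affine_chain_inE)
    have "affine_chain x = affine_chain (oriented_boundary y)"
      using w(2) unfolding v(3) chain_boundary_add chain_boundary_boundary_alt[OF v(2)] y(2) bd[OF y(1)] by simp
    then have 0: "affine_chain (x - oriented_boundary y) = 0"
      by (simp add: affine_chain_def frag_extend_diff)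
    have "Poly_Mapping.keys (x - oriented_boundary y) \<subseteq> {J \<in> K. card J = Suc q}"
      using keys_diff[of x "oriented_boundary y"] kx keys_oriented_boundary[OF K y(1)] by blast
    then have "x - oriented_boundary y = 0"
      by (intro affine_chain_eq_0[OF subset_trans[OF _ finite_complex_faces[OF K]] 0])
    then show "\<exists>y. Poly_Mapping.keys y \<subseteq> {J \<in> K. card J = Suc (Suc q)} \<and> x = oriented_boundary y"
      using y(1) by (intro exI[of _ y]) simp
  next
    assume "\<exists>y. Poly_Mapping.keys y \<subseteq> {J \<in> K. card J = Suc (Suc q)} \<and> x = oriented_boundary y"
    then obtain y where y: "Poly_Mapping.keys y \<subseteq> {J \<in> K. card J = Suc (Suc q)}" "x = oriented_boundary y" by blast
    then show "\<exists>w. singular_chain (Suc q) ?Y w \<and> chain_boundary (Suc q) w = affine_chain x"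
      using affine_chain_in_imp_singular_chain[OF K affine_chain_in_affine_chain[OF y(1)]] bd[OF y(1)]
      by (intro exI[of _ "affine_chain y"]) simp
  qed
  finally show ?thesis .
qed

end

text \<open>
  The case of degrees in which every oriented cycle is a boundary, for an arbitrary trivial group.
\<close>

lemma conormal_homology_trivial_group:
  assumes X: "corner_space X \<noteq> {}" and H: "trivial_group H"
    and bd: "\<And>x. \<lbrakk>Poly_Mapping.keys x \<subseteq> faces X p; oriented_boundary x = 0\<rbrakk>
      \<Longrightarrow> \<exists>y. Poly_Mapping.keys y \<subseteq> faces X (p + 1) \<and> x = oriented_boundary y"
  shows "conormal_homology X p \<cong> H"
proof (rule conormal_homology_iso[OF X, where h = "\<lambda>_. \<one>\<^bsub>H\<^esub>"])
  show g: "group H" using H by (simp add: trivial_group_def)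
  have "0 \<in> {x. Poly_Mapping.keys x \<subseteq> faces X p \<and> oriented_boundary x = 0}"
    by (simp add: oriented_boundary_def)
  then show "(\<lambda>_. \<one>\<^bsub>H\<^esub>) ` {x. Poly_Mapping.keys x \<subseteq> faces X p \<and> oriented_boundary x = 0} = carrier H"
    using H unfolding trivial_group_def by blast
  show "\<one>\<^bsub>H\<^esub> = \<one>\<^bsub>H\<^esub> \<otimes>\<^bsub>H\<^esub> \<one>\<^bsub>H\<^esub>"
    using g by (simp add: group.is_monoid)
qed (use bd in blast)

theorem theorem4p6:
  fixes X :: "'a corner_data" and p :: int
  assumes "compact_manifold_embedded_corners X"
    and "all_faces_connected X"
  shows "if topspace (geometric_realization (corner_structure_complex X)) = {} \<and> p - 1 = -1
         then conormal_homology X p \<cong> integer_group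
         else conormal_homology X p \<cong>
                reduced_homology_group (p - 1) (geometric_realization (corner_structure_complex X))"
proof -
  let ?K = "index_complex X" and ?\<Sigma> = "corner_structure_complex X"
  let ?R = "geometric_realization ?\<Sigma>"
  have X: "corner_space X \<noteq> {}" using assms(1) by (simp add: compact_manifold_embedded_corners_def)
  have K: "finite_complex ?K" by (rule finite_complex_index_complex[OF X])
  have empty_iff: "topspace ?R = {} \<longleftrightarrow> \<Union>?K = {}"
  proof -
    have "topspace ?R = {} \<longleftrightarrow> \<Union>?\<Sigma> = {}"
      unfolding geometric_realization_eq
      using realization_set_eq_empty_iff[OF finite_complex_corner_structure_complex] by simp
    also have "\<dots> \<longleftrightarrow> \<Union>?K = {}"
      using index_complex_image[of _ X] corner_structure_complex_index[OF X] by blast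
    finally show ?thesis .
  qed
  \<comment> \<open>In degree 0 the empty simplex is a cycle, and it bounds precisely when there is a vertex.\<close>
  consider (neg) "p < 0" | (empty) "p = 0" "\<Union>?K = {}" | (zero) "p = 0" "\<Union>?K \<noteq> {}" | (pos) q where "p = int (Suc q)"
    by (metis linorder_neqE_linordered_idom pos_int_cases gr0_conv_Suc)
  then show ?thesis
  proof cases
    case neg
    have "conormal_homology X p \<cong> reduced_homology_group (p - 1) ?R"
    proof (rule conormal_homology_trivial_group[OF X trivial_reduced_homology_group])
      show "p - 1 < 0" using neg by simp
      fix x :: "nat set \<Rightarrow>\<^sub>0 int" assume "Poly_Mapping.keys x \<subseteq> faces X p"
      then have "Poly_Mapping.keys x \<subseteq> {}" using neg by auto
      then show "\<exists>y. Poly_Mapping.keys y \<subseteq> faces X (p + 1) \<and> x = oriented_boundary y"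
        by (intro exI[of _ 0]) (simp add: oriented_boundary_def)
    qed
    then show ?thesis using neg by simp
  next
    case empty
    have faces0: "faces X p = {{}}" and faces1: "faces X (p + 1) = {}"
      using empty K by (auto simp: finite_complex_def)
    have cycles: "{x. Poly_Mapping.keys x \<subseteq> faces X p \<and> oriented_boundary x = 0} = {x. Poly_Mapping.keys x \<subseteq> {{}}}"
      unfolding faces0 using oriented_boundary_empty_face by blast
    have "conormal_homology X p \<cong> integer_group"
    proof (rule conormal_homology_iso[OF X, where h = "\<lambda>x. Poly_Mapping.lookup x {}"]; (unfold cycles faces1)?)
      show "group integer_group" by simp
      show "(\<lambda>x. Poly_Mapping.lookup x {}) ` {x :: nat set \<Rightarrow>\<^sub>0 int. Poly_Mapping.keys x \<subseteq> {{}}} = carrier integer_group"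
      proof (intro equalityI subsetI)
        fix k :: int
        show "k \<in> (\<lambda>x. Poly_Mapping.lookup x {}) ` {x :: nat set \<Rightarrow>\<^sub>0 int. Poly_Mapping.keys x \<subseteq> {{}}}"
          by (rule image_eqI[of _ _ "frag_cmul k (frag_of {})"]) auto
      qed simp
      show "Poly_Mapping.lookup (x + y) {} = Poly_Mapping.lookup x {} \<otimes>\<^bsub>integer_group\<^esub> Poly_Mapping.lookup y {}"
        for x y :: "nat set \<Rightarrow>\<^sub>0 int" by (simp add: lookup_add)
      fix x :: "nat set \<Rightarrow>\<^sub>0 int" assume "x \<in> {x. Poly_Mapping.keys x \<subseteq> {{}}}"
      then have x: "Poly_Mapping.keys x \<subseteq> {{}}" by simp
      have "Poly_Mapping.lookup x {} = 0 \<longleftrightarrow> {} \<notin> Poly_Mapping.keys x"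
        by (simp add: in_keys_iff)
      also have "\<dots> \<longleftrightarrow> Poly_Mapping.keys x = {}" using x by blast
      also have "\<dots> \<longleftrightarrow> x = 0" by simp
      finally have "Poly_Mapping.lookup x {} = 0 \<longleftrightarrow> x = 0" .
      then show "Poly_Mapping.lookup x {} = \<one>\<^bsub>integer_group\<^esub> \<longleftrightarrow> (\<exists>y. Poly_Mapping.keys y \<subseteq> {} \<and> x = oriented_boundary y)"
        by (auto simp: oriented_boundary_def)
    qed
    then show ?thesis using empty empty_iff by simp
  next
    case zero
    obtain j where j: "{j} \<in> ?K" using zero(2) finite_complex_subset[OF K] by blast
    have "conormal_homology X p \<cong> reduced_homology_group (p - 1) ?R"
    proof (rule conormal_homology_trivial_group[OF X trivial_reduced_homology_group])
      show "p - 1 < 0" using zero by simp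
      fix x :: "nat set \<Rightarrow>\<^sub>0 int" assume "Poly_Mapping.keys x \<subseteq> faces X p"
      then have x: "Poly_Mapping.keys x \<subseteq> {{}}" using zero finite_complex_finite[OF K] by auto
      \<comment> \<open>The empty simplex is the boundary of the vertex \<open>j\<close>.\<close>
      let ?y = "frag_extend (cone_face j) x"
      have "oriented_boundary ?y = x"
      proof -
        have "oriented_boundary ?y + frag_extend (cone_face j) (oriented_boundary x) = x"
          by (rule cone_oriented_boundary) (use x in auto)
        then show ?thesis by (simp add: oriented_boundary_empty_face[OF x])
      qed
      moreover have "Poly_Mapping.keys ?y \<subseteq> faces X (p + 1)"
        by (rule subset_trans[OF keys_frag_extend], rule UN_least)
          (use x j zero in \<open>auto simp: cone_face_def\<close>)
      ultimately show "\<exists>y. Poly_Mapping.keys y \<subseteq> faces X (p + 1) \<and> x = oriented_boundary y"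
        by (intro exI[of _ ?y]) simp
    qed
    moreover have "topspace ?R \<noteq> {}" using zero(2) empty_iff by blast
    ultimately show ?thesis by (simp only: simp_thms if_False)
  next
    case pos
    have faces: "faces X p = {J \<in> ?K. card J = Suc q}" "faces X (p + 1) = {J \<in> ?K. card J = Suc (Suc q)}"
      using pos by auto
    have "conormal_homology X p \<cong> reduced_homology_group (int q) (geometric_realization ?K)"
      by (rule conormal_homology_iso[OF X group_reduced_homology_group]; (unfold faces)?)
        (fact affine_class_image[OF K] affine_class_add[OF K] affine_class_eq_one[OF K])+
    moreover have "reduced_homology_group (int q) (geometric_realization ?K) \<cong> reduced_homology_group (int q) ?R"
      by (rule homotopy_equivalent_space_imp_isomorphic_reduced_homology_groups[OF homotopy_equivalent_index_realization[OF X]])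
    ultimately have "conormal_homology X p \<cong> reduced_homology_group (int q) ?R" by (rule iso_trans)
    then show ?thesis using pos by simp
  qed
qed

end
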